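(* Let $\kappa$ be a strongly inaccessible cardinal. The class of all abelian groups of size less than $\kappa$, together with pure embeddings, is a Fraïssé class (of length $\kappa$). In particular, there exists an abelian group $\mathbb{F}_\kappa$ of size $\kappa$, unique up to isomorphism, that is pure-injective for the class of abelian groups of size less than $\kappa$. The group $\mathbb{F}_\kappa$ is isomorphic to the ${<}\kappa$-supported product of length $\kappa$ of all co-cyclic groups, where the isomorphism type of every co-cyclic group appears $\kappa$ many times.
   Context: All groups are abelian. A subgroup $A\leq B$ is pure if for every $a\in A$ and every integer $k\geq 1$, if $a=k\cdot b$ for some $b\in B$, then $a=k\cdot a'$ for some $a'\in A$. A pure embedding is an injective homomorphism whose image is a pure subgroup of the codomain. A co-cyclic group is a group isomorphic to $\mathbb{Z}(p^n)$ for some prime $p$ and some $n\in\mathbb N\cup\{\infty\}$, where $\mathbb{Z}(p^n)$ for finite $n$ is the cyclic group of order $p^n$ and $\mathbb{Z}(p^\infty)$ is the quasi-cyclic (Prüfer) $p$-group. The ${<}\kappa$-supported product of a family of groups $(H_\alpha)_{\alpha<\kappa}$ is the subgroup of $\prod_{\alpha<\kappa}H_\alpha$ consisting of all elements whose support (the set of coordinates at which they are non-zero) has cardinality less than $\kappa$. A class $\mathcal K$ of groups of size less than $\kappa$ with pure embeddings is a Fraïssé class of length $\kappa$ if: (1) (Joint Embedding Property) any $a,b\in\mathcal K$ both purely embed into some $c\in\mathcal K$; (2) (Amalgamation Property) for any pure embeddings $f:a\to b$, $g:a\to c$ with $a,b,c\in\mathcal K$ there are $d\in\mathcal K$ and pure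 embeddings $f':b\to d$, $g':c\to d$ with $f'\circ f=g'\circ g$; (3) $\mathcal K$ is closed under pure subgroups; (4) $\mathcal K$ is ${<}\kappa$-closed: for every limit ordinal $\delta<\kappa$ and every sequence $\{A_\alpha\mid\alpha<\delta\}$ in $\mathcal K$ with $A_\alpha$ a pure subgroup of $A_\beta$ for $\alpha<\beta<\delta$ and $A_\beta=\bigcup_{\alpha<\beta}A_\alpha$ for limit $\beta<\delta$, the union $A_\delta=\bigcup_{\alpha<\delta}A_\alpha$ belongs to $\mathcal K$ and each $A_\alpha$ is pure in $A_\delta$. A group $\mathbb A$ is pure-injective for a class $\mathcal K$ of groups if for all $B,C\in\mathcal K$ with $B$ a pure subgroup of $C$, every pure embedding $f:B\to\mathbb A$ extends to a pure embedding $\overline f:C\to\mathbb A$. (This differs from the usual algebraic meaning of "pure-injective".) *)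

theory Defs
  imports Complex_Main "HOL-Library.Extended_Nat" "HOL-Computational_Algebra.Primes"
    "HOL-Algebra.Elementary_Groups" "HOL-Algebra.Product_Groups"
begin

unbundle cardinal_syntax

text \<open>
  Abelian groups are the multiplicative \<^locale>\<open>comm_group\<close>s of HOL-Algebra, so that a multiple
  \<open>k \<cdot> b\<close> is written as the power \<open>b [^] k\<close>. A cardinal is a relation \<open>\<kappa>\<close> with
  \<^const>\<open>Card_order\<close>; the ordinals below \<open>\<kappa>\<close> are the elements \<open>\<delta>\<close> of \<open>Field \<kappa>\<close>, and the
  ordinals below \<open>\<delta>\<close> are the elements of \<open>underS \<kappa> \<delta>\<close>.
\<close>


subsection \<open>Cardinals\<close>

text \<open>
  Every cardinal \<open>\<lambda> < \<kappa>\<close> is the cardinality of a subset of the type \<open>'k\<close> carrying \<open>\<kappa>\<close>, so the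
  strong limit condition need only range over such sets.
\<close>

definition strongly_inaccessible :: "'k rel \<Rightarrow> bool" where
  "strongly_inaccessible \<kappa> \<longleftrightarrow>
     Card_order \<kappa> \<and> natLeq <o \<kappa> \<and> regularCard \<kappa> \<and>
     (\<forall>X :: 'k set. |X| <o \<kappa> \<longrightarrow> |Pow X| <o \<kappa>)"

definition limit_point :: "'k rel \<Rightarrow> 'k \<Rightarrow> bool" where
  "limit_point \<kappa> \<delta> \<longleftrightarrow>
     \<delta> \<in> Field \<kappa> \<and> underS \<kappa> \<delta> \<noteq> {} \<and>
     (\<forall>\<alpha>\<in>underS \<kappa> \<delta>. \<exists>\<beta>\<in>underS \<kappa> \<delta>. \<alpha> \<in> underS \<kappa> \<beta>)"


subsection \<open>Purity\<close>

definition pure_subset :: "'a set \<Rightarrow> 'a monoid \<Rightarrow> bool" where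
  "pure_subset S B \<longleftrightarrow>
     subgroup S B \<and>
     (\<forall>a\<in>S. \<forall>k::nat. k \<ge> 1 \<longrightarrow>
        (\<exists>b\<in>carrier B. a = b [^]\<^bsub>B\<^esub> k) \<longrightarrow> (\<exists>a'\<in>S. a = a' [^]\<^bsub>B\<^esub> k))"

text \<open>
  For two group records, being a pure subgroup includes agreement of the operations. The
  multiplication of a record is arbitrary outside its carrier and is not compared there.
\<close>

definition pure_subgroup :: "'a monoid \<Rightarrow> 'a monoid \<Rightarrow> bool" where
  "pure_subgroup A B \<longleftrightarrow>
     pure_subset (carrier A) B \<and> \<one>\<^bsub>A\<^esub> = \<one>\<^bsub>B\<^esub> \<and>
     (\<forall>x\<in>carrier A. \<forall>y\<in>carrier A. x \<otimes>\<^bsub>A\<^esub> y = x \<otimes>\<^bsub>B\<^esub> y)"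

definition pure_embedding :: "('a \<Rightarrow> 'b) \<Rightarrow> 'a monoid \<Rightarrow> 'b monoid \<Rightarrow> bool" where
  "pure_embedding f A B \<longleftrightarrow>
     f \<in> hom A B \<and> inj_on f (carrier A) \<and> pure_subset (f ` carrier A) B"

definition pure_injective_for :: "'b monoid \<Rightarrow> 'a monoid set \<Rightarrow> bool" where
  "pure_injective_for A K \<longleftrightarrow>
     (\<forall>B\<in>K. \<forall>C\<in>K. pure_subgroup B C \<longrightarrow>
        (\<forall>f. pure_embedding f B A \<longrightarrow>
           (\<exists>g. pure_embedding g C A \<and> (\<forall>x\<in>carrier B. g x = f x))))"


subsection \<open>Fraisse classes\<close>

text \<open>
  A class of groups is a set of groups whose carriers lie in a fixed type \<open>'a\<close>. Provided
  \<open>\<kappa> \<le>o |UNIV :: 'a set|\<close>, every abelian group of size less than \<open>\<kappa>\<close> has an isomorphic copy on \<open>'a\<close>.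
\<close>

definition small_groups :: "'k rel \<Rightarrow> 'a monoid set" where
  "small_groups \<kappa> = {G. comm_group G \<and> |carrier G| <o \<kappa>}"

text \<open>The union of an increasing family of groups, each a subgroup of the later ones.\<close>

definition union_group :: "'i set \<Rightarrow> ('i \<Rightarrow> 'a monoid) \<Rightarrow> 'a monoid" where
  "union_group I A =
     \<lparr>carrier = (\<Union>i\<in>I. carrier (A i)),
      monoid.mult = (\<lambda>x y. THE z. \<exists>i\<in>I. x \<in> carrier (A i) \<and> y \<in> carrier (A i) \<and> z = x \<otimes>\<^bsub>A i\<^esub> y),
      one = (THE e. \<exists>i\<in>I. e = \<one>\<^bsub>A i\<^esub>)\<rparr>"

definition joint_embedding :: "'a monoid set \<Rightarrow> bool" where
  "joint_embedding K \<longleftrightarrow>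
     (\<forall>A\<in>K. \<forall>B\<in>K. \<exists>C\<in>K. (\<exists>f. pure_embedding f A C) \<and> (\<exists>g. pure_embedding g B C))"

definition amalgamation :: "'a monoid set \<Rightarrow> bool" where
  "amalgamation K \<longleftrightarrow>
     (\<forall>A\<in>K. \<forall>B\<in>K. \<forall>C\<in>K. \<forall>f g. pure_embedding f A B \<and> pure_embedding g A C \<longrightarrow>
        (\<exists>D\<in>K. \<exists>f' g'. pure_embedding f' B D \<and> pure_embedding g' C D \<and>
           (\<forall>x\<in>carrier A. f' (f x) = g' (g x))))"

definition closed_under_pure_subgroups :: "'a monoid set \<Rightarrow> bool" where
  "closed_under_pure_subgroups K \<longleftrightarrow> (\<forall>B\<in>K. \<forall>A. pure_subgroup A B \<longrightarrow> A \<in> K)"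

definition chain_closed :: "'k rel \<Rightarrow> 'a monoid set \<Rightarrow> bool" where
  "chain_closed \<kappa> K \<longleftrightarrow>
     (\<forall>\<delta> A. limit_point \<kappa> \<delta> \<and>
        (\<forall>\<alpha>\<in>underS \<kappa> \<delta>. A \<alpha> \<in> K) \<and>
        (\<forall>\<beta>\<in>underS \<kappa> \<delta>. \<forall>\<alpha>\<in>underS \<kappa> \<beta>. pure_subgroup (A \<alpha>) (A \<beta>)) \<and>
        (\<forall>\<beta>\<in>underS \<kappa> \<delta>. limit_point \<kappa> \<beta> \<longrightarrow>
           carrier (A \<beta>) = (\<Union>\<alpha>\<in>underS \<kappa> \<beta>. carrier (A \<alpha>))) \<longrightarrow>
        union_group (underS \<kappa> \<delta>) A \<in> K \<and>
        (\<forall>\<alpha>\<in>underS \<kappa> \<delta>. pure_subgroup (A \<alpha>) (union_group (underS \<kappa> \<delta>) A)))"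

definition fraisse_class :: "'k rel \<Rightarrow> 'a monoid set \<Rightarrow> bool" where
  "fraisse_class \<kappa> K \<longleftrightarrow>
     K \<subseteq> small_groups \<kappa> \<and> joint_embedding K \<and> amalgamation K \<and>
     closed_under_pure_subgroups K \<and> chain_closed \<kappa> K"


subsection \<open>Co-cyclic groups and supported products\<close>

text \<open>The quasi-cyclic \<open>p\<close>-group, realised as the group of complex \<open>p\<close>-power roots of unity.\<close>

definition pruefer_group :: "nat \<Rightarrow> complex monoid" where
  "pruefer_group p =
     \<lparr>carrier = {z. \<exists>n::nat. z ^ (p ^ n) = 1}, monoid.mult = (*), one = 1\<rparr>"

text \<open>\<open>G\<close> is isomorphic to \<open>\<int>(p\<^sup>n)\<close>, where \<open>n\<close> may be \<open>\<infinity>\<close>.\<close>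

definition cocyclic_of_type :: "nat \<Rightarrow> enat \<Rightarrow> 'a monoid \<Rightarrow> bool" where
  "cocyclic_of_type p n G \<longleftrightarrow>
     comm_group G \<and>
     (case n of enat m \<Rightarrow> G \<cong> integer_mod_group (p ^ m) | \<infinity> \<Rightarrow> G \<cong> pruefer_group p)"

definition cocyclic :: "'a monoid \<Rightarrow> bool" where
  "cocyclic G \<longleftrightarrow> (\<exists>p n. prime p \<and> cocyclic_of_type p n G)"

definition cocyclic_family :: "'k rel \<Rightarrow> ('k \<Rightarrow> 'a monoid) \<Rightarrow> bool" where
  "cocyclic_family \<kappa> H \<longleftrightarrow>
     (\<forall>\<alpha>\<in>Field \<kappa>. cocyclic (H \<alpha>)) \<and>
     (\<forall>p n. prime p \<longrightarrow> |{\<alpha> \<in> Field \<kappa>. cocyclic_of_type p n (H \<alpha>)}| =o \<kappa>)"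

definition supported_product :: "'k rel \<Rightarrow> ('k \<Rightarrow> 'a monoid) \<Rightarrow> ('k \<Rightarrow> 'a) monoid" where
  "supported_product \<kappa> H =
     (product_group (Field \<kappa>) H)
       \<lparr>carrier := {x \<in> carrier (product_group (Field \<kappa>) H).
                      |{\<alpha> \<in> Field \<kappa>. x \<alpha> \<noteq> \<one>\<^bsub>H \<alpha>\<^esub>}| <o \<kappa>}\<rparr>"

end

theory Submission
  imports Defs "HOL-Library.Countable_Set_Type" "HOL-Number_Theory.Cong" "HOL-Algebra.Weak_Morphisms"
begin

text \<open>
  Let \<open>P\<close> be the \<open><\<kappa>\<close>-supported product. Given a small pure extension \<open>B \<le> C\<close> and a pure embedding
  \<open>f : B \<rightarrow> P\<close>, the coordinates of \<open>f\<close> extend to \<open>C\<close> because every co-cyclic group is algebraically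
  compact, and fewer than \<open>\<kappa>\<close> coordinates occur. Fresh coordinates carry homomorphisms that kill \<open>B\<close>
  and, for every \<open>c\<close> and \<open>k\<close> with \<open>c \<notin> B + kC\<close>, one of them sends \<open>c\<close> to a nonzero element of a
  co-cyclic group annihilated by \<open>k\<close>. The case \<open>k = 0\<close> makes the extension injective, the case
  \<open>k \<ge> 1\<close> makes its image pure. So \<open>P\<close> is pure-injective for small groups; it has size \<open>\<kappa>\<close> because \<open>\<kappa>\<close>
  is a regular strong limit. A back-and-forth of length \<open>\<kappa>\<close> shows that such groups are unique, and
  amalgamation of small groups can be carried out inside \<open>P\<close> instead of forming pushouts.
\<close>


subsection \<open>Cardinal arithmetic below an inaccessible cardinal\<close>

text \<open>Homomorphisms into a finite co-cyclic p-group are treated as homomorphisms into the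
  quasi-cyclic group with values annihilated by a power of p. Algebraic compactness of the
  coordinates thus reduces to injectivity of divisible groups, purity being what makes the exponent
  condition compatible with the given map. Purity of the extension is detected because k annihilates
  the coordinate reserved for (c, k): if the image of c is k-divisible in P, then c = b + kd with b
  in B, and purity of f divides b by k. Coordinates can be reserved since there are fewer than
  \<kappa> pairs (c, k), while each type occurs \<kappa> times.

  Pure-injectivity is stated for groups on one fixed type and for literal inclusions. Hence groups
  are copied along injections, embeddings are replaced by inclusions of their images, and uniqueness
  tests each of two groups on small subgroups of the other. An amalgam must itself be small, so it
  is cut out of the big group as a small pure subgroup containing both images; this uses that
  \<kappa> is uncountable.\<close>

locale inaccessible =
  fixes \<kappa> :: "'k rel"
  assumes inaccessible: "strongly_inaccessible \<kappa>"
begin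

abbreviation small :: "'x set \<Rightarrow> bool" where
  "small S \<equiv> |S| <o \<kappa>"

lemma card_order: "Card_order \<kappa>"
  and uncountable: "natLeq <o \<kappa>"
  and regular: "regularCard \<kappa>"
  using inaccessible unfolding strongly_inaccessible_def by auto

lemma infinite_Field: "infinite (Field \<kappa>)"
  using cinfinite_mono[OF ordLess_imp_ordLeq[OF uncountable] natLeq_cinfinite]
  unfolding cinfinite_def .

lemma cinfinite: "Cinfinite \<kappa>"
  using card_order infinite_Field unfolding cinfinite_def by auto

lemma wo_rel: "wo_rel \<kappa>"
  using card_order unfolding card_order_on_def wo_rel_def by auto

lemma small_subset: "small T \<Longrightarrow> S \<subseteq> T \<Longrightarrow> small S"
  using card_of_mono1 ordLeq_ordLess_trans by blast

lemma small_image: "small S \<Longrightarrow> small (f ` S)"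
  using card_of_image ordLeq_ordLess_trans by blast

lemma small_inj_on: "inj_on f S \<Longrightarrow> f ` S \<subseteq> T \<Longrightarrow> small T \<Longrightarrow> small S"
  using card_of_ordLeqI ordLeq_ordLess_trans by (metis image_subset_iff)

lemma small_countable:
  assumes "countable S"
  shows "small S"
proof -
  have "|S| \<le>o natLeq"
    using assms unfolding countable_card_of_nat
    using card_of_nat ordLeq_ordIso_trans by blast
  then show ?thesis
    using uncountable ordLeq_ordLess_trans by blast
qed

lemma small_UN: "small I \<Longrightarrow> (\<And>i. i \<in> I \<Longrightarrow> small (A i)) \<Longrightarrow> small (\<Union>i\<in>I. A i)"
  using cinfinite regular regularCard_UNION_bound by blast

lemma small_Un: "small S \<Longrightarrow> small T \<Longrightarrow> small (S \<union> T)"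
  using card_of_Un_ordLess_infinite_Field infinite_Field card_order by blast

lemma small_Times:
  assumes "small S" "small T"
  shows "small (S \<times> T)"
proof -
  have "S \<times> T = (\<Union>s\<in>S. Pair s ` T)" by auto
  then show ?thesis using small_UN[OF assms(1) small_image[OF assms(2)]] by simp
qed

text \<open>The strong limit condition only speaks of subsets of the type that carries \<kappa>, so
  S is first replaced by an equipotent subset of \<open>Field \<kappa>\<close>; power sets follow
  along the bijection.\<close>

lemma small_Pow:
  fixes S :: "'x set"
  assumes "small S"
  shows "small (Pow S)"
proof -
  obtain X where X: "|S| =o |X|" "X \<subseteq> Field \<kappa>"
    using iffD1[OF internalize_card_of_ordLeq ordLess_imp_ordLeq[OF assms]] by blast
  then obtain f where "bij_betw f S X"
    using iffD2[OF card_of_ordIso] by blast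
  then have "bij_betw (image f) (Pow S) (Pow X)"
    by (rule bij_betw_Pow)
  moreover have "small X"
    by (rule ordIso_ordLess_trans[OF ordIso_symmetric[OF X(1)] assms])
  then have "small (Pow X)"
    using inaccessible unfolding strongly_inaccessible_def by blast
  ultimately show ?thesis
    using small_inj_on[of "image f" "Pow S" "Pow X"] by (simp add: bij_betw_def)
qed

lemma small_underS: "a \<in> Field \<kappa> \<Longrightarrow> small (underS \<kappa> a)"
  by (rule card_of_underS[OF card_order])

lemma small_bounded:
  assumes "X \<subseteq> Field \<kappa>" "small X"
  obtains a where "a \<in> Field \<kappa>" "X \<subseteq> underS \<kappa> a"
proof -
  have "\<not> cofinal X \<kappa>"
    using assms(1) regular not_ordLess_ordIso[OF assms(2)] unfolding regularCard_def by blast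
  then obtain a where a: "a \<in> Field \<kappa>" "\<forall>b\<in>X. a = b \<or> (a, b) \<notin> \<kappa>"
    unfolding cofinal_def by blast
  then have ba: "(b, a) \<in> \<kappa>" if "b \<in> X" for b
    using that assms(1) wo_rel.TOTALS[OF wo_rel] by (metis subsetD)
  \<comment> \<open>Regularity bounds X only weakly, by b \<le> a; since \<kappa> has no largest
    element, moving on to a larger c makes the bound strict.\<close>
  obtain c where c: "a \<noteq> c" "(a, c) \<in> \<kappa>"
    using infinite_Card_order_limit[OF card_order infinite_Field a(1)] by blast
  have "X \<subseteq> underS \<kappa> c"
  proof
    fix b assume "b \<in> X"
    then have "(b, a) \<in> \<kappa>" using ba by blast
    then show "b \<in> underS \<kappa> c"
      using c wo_rel.TRANS[OF wo_rel] wo_rel.ANTISYM[OF wo_rel]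
      unfolding underS_def trans_def antisym_def by blast
  qed
  moreover have "c \<in> Field \<kappa>" using c by (auto simp: Field_def)
  ultimately show ?thesis using that by blast
qed

lemma not_small: "|T| =o \<kappa> \<Longrightarrow> \<not> small T"
  using not_ordLess_ordIso[of "|T|" \<kappa>] by auto

lemma card_eq_kappa:
  assumes "|S| \<le>o \<kappa>" "\<not> small S"
  shows "|S| =o \<kappa>"
  using assms by (simp add: ordLeq_iff_ordLess_or_ordIso)

lemma card_UN_le:
  assumes "|I| \<le>o \<kappa>" "\<And>i. i \<in> I \<Longrightarrow> |A i| \<le>o \<kappa>"
  shows "|\<Union>i\<in>I. A i| \<le>o \<kappa>"
  by (rule card_of_UNION_ordLeq_infinite_Field[OF infinite_Field card_order]) (use assms in auto)

text \<open>Greedy choice along a well-order of I: at each i the forbidden elements, S and the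
  values already chosen, form a small set, which cannot exhaust T i. This is what reserves fresh
  coordinates later.\<close>

lemma injective_selection:
  fixes T :: "'i \<Rightarrow> 'x set"
  assumes I: "small I" and S: "small S" and T: "\<And>i. i \<in> I \<Longrightarrow> \<not> small (T i)"
  obtains t where "inj_on t I" "\<And>i. i \<in> I \<Longrightarrow> t i \<in> T i - S"
proof -
  interpret I: wo_rel "|I|"
    by (simp add: wo_rel_def card_of_Well_order)
  define H where "H = (\<lambda>f i. SOME x. x \<in> T i - (S \<union> f ` I.underS i))"
  define t where "t = I.worec H"
  \<comment> \<open>\<open>H\<close> consults f only strictly below i, which is what licenses the
    recursion.\<close>
  have "I.adm_wo H"
    unfolding I.adm_wo_def H_def by (auto cong: image_cong)
  then have t_eq: "t = H t"
    unfolding t_def using I.worec_fixpoint by blast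
  have t: "t i \<in> T i - (S \<union> t ` I.underS i)" if "i \<in> I" for i
  proof -
    have "I.underS i \<subseteq> I"
      using Field_card_of[of I] by (auto simp: underS_def Field_def)
    then have "small (S \<union> t ` I.underS i)"
      using I S small_Un small_image small_subset by meson
    then have "\<exists>x. x \<in> T i - (S \<union> t ` I.underS i)"
      using T[OF that] small_subset by blast
    from someI_ex[OF this] have "H t i \<in> T i - (S \<union> t ` I.underS i)"
      unfolding H_def .
    then show ?thesis using t_eq by simp
  qed
  have "inj_on t I"
  proof (rule inj_onI)
    fix i j assume ij: "i \<in> I" "j \<in> I" "t i = t j"
    have "i \<in> I.underS j \<or> j \<in> I.underS i \<or> i = j"
      using ij I.TOTALS unfolding underS_def by (auto simp: Field_card_of)
    then show "i = j"
      using t[OF ij(1)] t[OF ij(2)] ij(3) by (metis DiffD2 UnI2 imageI)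
  qed
  then show ?thesis using t that by blast
qed

end


subsection \<open>Extending homomorphisms into divisible groups\<close>

lemma int_pow_DirProd:
  assumes "group G" "group H" "a \<in> carrier G" "b \<in> carrier H"
  shows "(a, b) [^]\<^bsub>G \<times>\<times> H\<^esub> (j::int) = (a [^]\<^bsub>G\<^esub> j, b [^]\<^bsub>H\<^esub> j)"
proof -
  have GH: "group (G \<times>\<times> H)"
    using assms DirProd_group by blast
  have "fst \<in> hom (G \<times>\<times> H) G" "snd \<in> hom (G \<times>\<times> H) H"
    by (auto simp: hom_def)
  then have "fst ((a, b) [^]\<^bsub>G \<times>\<times> H\<^esub> j) = a [^]\<^bsub>G\<^esub> j" "snd ((a, b) [^]\<^bsub>G \<times>\<times> H\<^esub> j) = b [^]\<^bsub>H\<^esub> j"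
    using hom_int_pow[of fst "G \<times>\<times> H" G "(a, b)" j] hom_int_pow[of snd "G \<times>\<times> H" H "(a, b)" j] GH assms
    by auto
  then show ?thesis
    by (metis prod.collapse)
qed

lemma comm_group_mult_swap:
  assumes "comm_group G" "a \<in> carrier G" "b \<in> carrier G" "c \<in> carrier G" "d \<in> carrier G"
  shows "(a \<otimes>\<^bsub>G\<^esub> b) \<otimes>\<^bsub>G\<^esub> (c \<otimes>\<^bsub>G\<^esub> d) = (a \<otimes>\<^bsub>G\<^esub> c) \<otimes>\<^bsub>G\<^esub> (b \<otimes>\<^bsub>G\<^esub> d)"
proof -
  interpret comm_group G by fact
  show ?thesis using assms by (simp add: m_ac)
qed


text \<open>
  Partial homomorphisms are handled as subgroups of the product, so that enlarging them is inclusion;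
  such a relation is single-valued as soon as its fibre over the unit is trivial.
\<close>

definition hom_graph :: "'a monoid \<Rightarrow> 'b monoid \<Rightarrow> ('a \<times> 'b) set \<Rightarrow> bool" where
  "hom_graph G H R \<longleftrightarrow> subgroup R (G \<times>\<times> H) \<and> (\<forall>y. (\<one>\<^bsub>G\<^esub>, y) \<in> R \<longrightarrow> y = \<one>\<^bsub>H\<^esub>)"

lemma hom_graph_unique:
  assumes "group G" "group H" "hom_graph G H R" "(x, y) \<in> R" "(x, y') \<in> R"
  shows "y = y'"
proof -
  have R: "subgroup R (G \<times>\<times> H)"
    using assms unfolding hom_graph_def by blast
  have c: "x \<in> carrier G" "y \<in> carrier H" "y' \<in> carrier H"
    using subgroup.subset[OF R] assms by auto
  have "(x, y) \<otimes>\<^bsub>G \<times>\<times> H\<^esub> inv\<^bsub>G \<times>\<times> H\<^esub> (x, y') \<in> R"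
    using subgroup.m_closed[OF R] subgroup.m_inv_closed[OF R] assms by blast
  then have "(\<one>\<^bsub>G\<^esub>, y \<otimes>\<^bsub>H\<^esub> inv\<^bsub>H\<^esub> y') \<in> R"
    using c assms by (simp add: group.r_inv)
  then have "y \<otimes>\<^bsub>H\<^esub> inv\<^bsub>H\<^esub> y' = \<one>\<^bsub>H\<^esub>"
    using assms unfolding hom_graph_def by blast
  then show ?thesis
    using group.inv_equality[of H y "inv\<^bsub>H\<^esub> y'"] c assms(2) by (simp add: group.inv_inv)
qed

lemma hom_graph_hom:
  assumes "group G" "group H" "hom_graph G H R"
  obtains g where "g \<in> hom (G\<lparr>carrier := Domain R\<rparr>) H" "\<And>x y. (x, y) \<in> R \<Longrightarrow> g x = y"
proof -
  have R: "subgroup R (G \<times>\<times> H)"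
    using assms unfolding hom_graph_def by blast
  define g where "g x = (THE y. (x, y) \<in> R)" for x
  have g: "g x = y" if "(x, y) \<in> R" for x y
    unfolding g_def using that hom_graph_unique[OF assms] by blast
  have g': "(x, g x) \<in> R" if "x \<in> Domain R" for x
    using that g by (metis DomainE)
  have "g \<in> hom (G\<lparr>carrier := Domain R\<rparr>) H"
  proof (rule homI)
    fix x assume "x \<in> carrier (G\<lparr>carrier := Domain R\<rparr>)"
    then show "g x \<in> carrier H"
      using g' subgroup.subset[OF R] by auto
  next
    fix x y assume "x \<in> carrier (G\<lparr>carrier := Domain R\<rparr>)" "y \<in> carrier (G\<lparr>carrier := Domain R\<rparr>)"
    then have "(x, g x) \<otimes>\<^bsub>G \<times>\<times> H\<^esub> (y, g y) \<in> R"
      using g' subgroup.m_closed[OF R, of "(x, g x)" "(y, g y)"] by simp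
    then show "g (x \<otimes>\<^bsub>G\<lparr>carrier := Domain R\<rparr>\<^esub> y) = g x \<otimes>\<^bsub>H\<^esub> g y"
      using g by simp
  qed
  then show ?thesis using g that by blast
qed

text \<open>R is enlarged by the subgroup generated by (c, w). A collision can only come from a
  multiple of c already in the domain, where \<open>cw\<close> forces agreement; the fibre over the
  unit therefore stays trivial.\<close>

lemma hom_graph_insert:
  assumes G: "comm_group G" and H: "comm_group H" and R: "hom_graph G H R"
    and c: "c \<in> carrier G" and w: "w \<in> carrier H"
    and cw: "\<And>(j::int) y. (c [^]\<^bsub>G\<^esub> j, y) \<in> R \<Longrightarrow> y = w [^]\<^bsub>H\<^esub> j"
  obtains R' where "hom_graph G H R'" "R \<subseteq> R'" "(c, w) \<in> R'"
proof -
  interpret G: comm_group G by fact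
  interpret H: comm_group H by fact
  have sub: "subgroup R (G \<times>\<times> H)"
    using R unfolding hom_graph_def by blast
  have carr: "x \<in> carrier G" "y \<in> carrier H" if "(x, y) \<in> R" for x y
    using that subgroup.subset[OF sub] by auto
  have mult: "(x \<otimes>\<^bsub>G\<^esub> x', y \<otimes>\<^bsub>H\<^esub> y') \<in> R" if "(x, y) \<in> R" "(x', y') \<in> R" for x y x' y'
    using subgroup.m_closed[OF sub that] by simp
  have inv: "(inv\<^bsub>G\<^esub> x, inv\<^bsub>H\<^esub> y) \<in> R" if "(x, y) \<in> R" for x y
    using subgroup.m_inv_closed[OF sub that] carr[OF that] by simp
  have one: "(\<one>\<^bsub>G\<^esub>, \<one>\<^bsub>H\<^esub>) \<in> R"
    using subgroup.one_closed[OF sub] by simp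
  define R' where "R' = {(x \<otimes>\<^bsub>G\<^esub> c [^]\<^bsub>G\<^esub> j, y \<otimes>\<^bsub>H\<^esub> w [^]\<^bsub>H\<^esub> j) | x y (j::int). (x, y) \<in> R}"
  have R'I: "(x, y) \<in> R \<Longrightarrow> (x \<otimes>\<^bsub>G\<^esub> c [^]\<^bsub>G\<^esub> j, y \<otimes>\<^bsub>H\<^esub> w [^]\<^bsub>H\<^esub> j) \<in> R'" for x y and j :: int
    unfolding R'_def by blast
  interpret GH: group "G \<times>\<times> H"
    by (simp add: DirProd_group G.is_group H.is_group)
  have "subgroup R' (G \<times>\<times> H)"
  proof (rule GH.subgroupI)
    show "R' \<subseteq> carrier (G \<times>\<times> H)"
      unfolding R'_def using carr c w by auto
    show "R' \<noteq> {}"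
      using R'I one by blast
  next
    fix a assume "a \<in> R'"
    then obtain x y and j :: int where a: "a = (x \<otimes>\<^bsub>G\<^esub> c [^]\<^bsub>G\<^esub> j, y \<otimes>\<^bsub>H\<^esub> w [^]\<^bsub>H\<^esub> j)" "(x, y) \<in> R"
      unfolding R'_def by blast
    have "inv\<^bsub>G \<times>\<times> H\<^esub> a = (inv\<^bsub>G\<^esub> x \<otimes>\<^bsub>G\<^esub> c [^]\<^bsub>G\<^esub> (-j), inv\<^bsub>H\<^esub> y \<otimes>\<^bsub>H\<^esub> w [^]\<^bsub>H\<^esub> (-j))"
      using a carr[OF a(2)] c w
      by (simp add: G.is_group H.is_group G.inv_mult H.inv_mult G.int_pow_neg H.int_pow_neg)
    then show "inv\<^bsub>G \<times>\<times> H\<^esub> a \<in> R'"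
      using R'I[OF inv[OF a(2)]] by simp
  next
    fix a b assume "a \<in> R'" "b \<in> R'"
    then obtain x y x' y' and j i :: int
      where a: "a = (x \<otimes>\<^bsub>G\<^esub> c [^]\<^bsub>G\<^esub> j, y \<otimes>\<^bsub>H\<^esub> w [^]\<^bsub>H\<^esub> j)" "(x, y) \<in> R"
        and b: "b = (x' \<otimes>\<^bsub>G\<^esub> c [^]\<^bsub>G\<^esub> i, y' \<otimes>\<^bsub>H\<^esub> w [^]\<^bsub>H\<^esub> i)" "(x', y') \<in> R"
      unfolding R'_def by blast
    have "a \<otimes>\<^bsub>G \<times>\<times> H\<^esub> b = ((x \<otimes>\<^bsub>G\<^esub> x') \<otimes>\<^bsub>G\<^esub> c [^]\<^bsub>G\<^esub> (j + i), (y \<otimes>\<^bsub>H\<^esub> y') \<otimes>\<^bsub>H\<^esub> w [^]\<^bsub>H\<^esub> (j + i))"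
      using a b carr[OF a(2)] carr[OF b(2)] c w
      by (simp add: G.int_pow_mult H.int_pow_mult comm_group_mult_swap[OF G] comm_group_mult_swap[OF H])
    then show "a \<otimes>\<^bsub>G \<times>\<times> H\<^esub> b \<in> R'"
      using R'I[OF mult[OF a(2) b(2)]] by simp
  qed
  moreover have "z = \<one>\<^bsub>H\<^esub>" if z: "(\<one>\<^bsub>G\<^esub>, z) \<in> R'" for z
  proof -
    obtain x y and j :: int where xy: "\<one>\<^bsub>G\<^esub> = x \<otimes>\<^bsub>G\<^esub> c [^]\<^bsub>G\<^esub> j" "z = y \<otimes>\<^bsub>H\<^esub> w [^]\<^bsub>H\<^esub> j" "(x, y) \<in> R"
      using z unfolding R'_def by blast
    have "c [^]\<^bsub>G\<^esub> j = inv\<^bsub>G\<^esub> x"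
      using G.inv_equality[OF xy(1)[symmetric]] carr(1)[OF xy(3)] c by auto
    then have "inv\<^bsub>H\<^esub> y = w [^]\<^bsub>H\<^esub> j"
      using cw inv[OF xy(3)] by simp
    then show ?thesis
      using xy(2) H.r_inv[OF carr(2)[OF xy(3)]] by simp
  qed
  ultimately have "hom_graph G H R'"
    unfolding hom_graph_def by blast
  moreover have "R \<subseteq> R'"
  proof
    fix a assume "a \<in> R"
    then show "a \<in> R'"
      using R'I[of "fst a" "snd a" 0] carr[of "fst a" "snd a"] by simp
  qed
  moreover have "(c, w) \<in> R'"
    using R'I[OF one, of 1] c w by simp
  ultimately show ?thesis using that by blast
qed

definition divisible_group :: "'a monoid \<Rightarrow> bool" where
  "divisible_group G \<longleftrightarrow>
     comm_group G \<and> (\<forall>x\<in>carrier G. \<forall>k::nat. k \<ge> 1 \<longrightarrow> (\<exists>y\<in>carrier G. y [^]\<^bsub>G\<^esub> k = x))"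

text \<open>If d is the least positive exponent that brings c into the domain, the exponents doing
  so are the multiples of d, by division with remainder. So the compatibility required by
  \<open>hom_graph_insert\<close> need only be checked at d.\<close>

lemma hom_graph_Domain_pow:
  fixes d :: nat
  assumes G: "group G" and H: "group H" and R: "hom_graph G H R" and c: "c \<in> carrier G"
    and d: "\<And>n. 0 < n \<Longrightarrow> n < d \<Longrightarrow> c [^]\<^bsub>G\<^esub> n \<notin> Domain R" "d > 0"
    and w: "w \<in> carrier H" "(c [^]\<^bsub>G\<^esub> d, w [^]\<^bsub>H\<^esub> d) \<in> R"
    and j: "(c [^]\<^bsub>G\<^esub> (j::int), y) \<in> R"
  shows "y = w [^]\<^bsub>H\<^esub> j"
proof -
  interpret G: group G by fact
  interpret H: group H by fact
  interpret GH: group "G \<times>\<times> H"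
    by (simp add: DirProd_group G H)
  have sub: "subgroup R (G \<times>\<times> H)"
    using R unfolding hom_graph_def by blast
  define q r where "q = j div int d" and "r = j mod int d"
  have jqr: "j = int d * q + r" and r: "0 \<le> r" "r < int d"
    using d(2) by (auto simp: q_def r_def)
  have "(c [^]\<^bsub>G\<^esub> d, w [^]\<^bsub>H\<^esub> d) [^]\<^bsub>G \<times>\<times> H\<^esub> q \<in> R"
    using GH.subgroup_int_pow_closed[OF sub w(2)] .
  moreover have "(c [^]\<^bsub>G\<^esub> d, w [^]\<^bsub>H\<^esub> d) [^]\<^bsub>G \<times>\<times> H\<^esub> q = (c [^]\<^bsub>G\<^esub> (int d * q), w [^]\<^bsub>H\<^esub> (int d * q))"
    using c w by (simp add: int_pow_DirProd G H G.int_pow_pow H.int_pow_pow flip: int_pow_int)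
  ultimately have q: "(c [^]\<^bsub>G\<^esub> (int d * q), w [^]\<^bsub>H\<^esub> (int d * q)) \<in> R"
    by simp
  have y: "y \<in> carrier H"
    using j subgroup.subset[OF sub] by auto
  have "inv\<^bsub>G \<times>\<times> H\<^esub> (c [^]\<^bsub>G\<^esub> (int d * q), w [^]\<^bsub>H\<^esub> (int d * q)) \<otimes>\<^bsub>G \<times>\<times> H\<^esub> (c [^]\<^bsub>G\<^esub> j, y) \<in> R"
    using q j subgroup.m_closed[OF sub] subgroup.m_inv_closed[OF sub] by blast
  moreover have "inv\<^bsub>G\<^esub> (c [^]\<^bsub>G\<^esub> (int d * q)) \<otimes>\<^bsub>G\<^esub> c [^]\<^bsub>G\<^esub> j = c [^]\<^bsub>G\<^esub> nat r"
    using c r by (simp add: G.int_pow_mult jqr flip: int_pow_int G.m_assoc)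
  ultimately have "c [^]\<^bsub>G\<^esub> nat r \<in> Domain R"
    using c w y by (simp add: G H) blast
  then have "r = 0"
    using d(1)[of "nat r"] r by force
  then show ?thesis
    using hom_graph_unique[OF G H R j] q jqr by simp
qed

text \<open>Inversion turns a negative exponent into a positive one, so only j = 0 survives and any
  w is compatible.\<close>

lemma hom_graph_Domain_pow_free:
  assumes G: "group G" and H: "group H" and R: "hom_graph G H R" and c: "c \<in> carrier G"
    and free: "\<And>n::nat. 0 < n \<Longrightarrow> c [^]\<^bsub>G\<^esub> n \<notin> Domain R"
    and j: "(c [^]\<^bsub>G\<^esub> (j::int), y) \<in> R"
  shows "y = w [^]\<^bsub>H\<^esub> j"
proof -
  interpret G: group G by fact
  interpret H: group H by fact
  have sub: "subgroup R (G \<times>\<times> H)"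
    using R unfolding hom_graph_def by blast
  have "(inv\<^bsub>G\<^esub> (c [^]\<^bsub>G\<^esub> j), inv\<^bsub>H\<^esub> y) \<in> R"
    using subgroup.m_inv_closed[OF sub j] subgroup.subset[OF sub] c j G H by auto
  then have "(c [^]\<^bsub>G\<^esub> (- j), inv\<^bsub>H\<^esub> y) \<in> R"
    using c by (simp add: G.int_pow_neg)
  then have "c [^]\<^bsub>G\<^esub> nat \<bar>j\<bar> \<in> Domain R"
    using j by (cases "j \<ge> 0") (auto simp flip: int_pow_int)
  then have "j = 0"
    using free[of "nat \<bar>j\<bar>"] by (cases "j = 0") auto
  then show ?thesis
    using j R unfolding hom_graph_def by simp
qed

text \<open>If c has finite order d modulo the domain, divisibility supplies a d-th root w of the
  value already prescribed at \<open>c^d\<close>; otherwise w is arbitrary.\<close>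

lemma hom_graph_extend:
  assumes G: "comm_group G" and H: "divisible_group H" and R: "hom_graph G H R" and c: "c \<in> carrier G"
  obtains R' where "hom_graph G H R'" "R \<subseteq> R'" "c \<in> Domain R'"
proof -
  have H': "comm_group H"
    using H unfolding divisible_group_def by blast
  interpret G: comm_group G by fact
  interpret H: comm_group H by fact
  have sub: "subgroup R (G \<times>\<times> H)"
    using R unfolding hom_graph_def by blast
  have "\<exists>w\<in>carrier H. \<forall>(j::int) y. (c [^]\<^bsub>G\<^esub> j, y) \<in> R \<longrightarrow> y = w [^]\<^bsub>H\<^esub> j"
  proof (cases "\<exists>n::nat. n > 0 \<and> c [^]\<^bsub>G\<^esub> n \<in> Domain R")
    case True
    then obtain d :: nat where d: "d > 0" "c [^]\<^bsub>G\<^esub> d \<in> Domain R"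
      "\<And>n. n < d \<Longrightarrow> \<not> (n > 0 \<and> c [^]\<^bsub>G\<^esub> n \<in> Domain R)"
      using exists_least_iff[of "\<lambda>n. n > 0 \<and> c [^]\<^bsub>G\<^esub> n \<in> Domain R"] by blast
    then obtain y where y: "(c [^]\<^bsub>G\<^esub> d, y) \<in> R" by blast
    then have "y \<in> carrier H"
      using subgroup.subset[OF sub] by auto
    then obtain w where w: "w \<in> carrier H" "w [^]\<^bsub>H\<^esub> d = y"
      using H d(1) unfolding divisible_group_def by (metis Suc_leI One_nat_def)
    show ?thesis
      using hom_graph_Domain_pow[OF G.is_group H.is_group R c _ d(1) w(1)] d(3) y w by blast
  next
    case False
    then show ?thesis
      using hom_graph_Domain_pow_free[OF G.is_group H.is_group R c] by blast
  qed
  then obtain w where w: "w \<in> carrier H" "\<And>(j::int) y. (c [^]\<^bsub>G\<^esub> j, y) \<in> R \<Longrightarrow> y = w [^]\<^bsub>H\<^esub> j"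
    by blast
  obtain R' where R': "hom_graph G H R'" "R \<subseteq> R'" "(c, w) \<in> R'"
    by (rule hom_graph_insert[OF G H' R c w])
  show ?thesis
    by (rule that[OF R'(1,2)]) (use R'(3) in blast)
qed

lemma hom_graph_Union_chain:
  assumes G: "group G" and H: "group H" and "C \<noteq> {}" and C: "subset.chain {R. hom_graph G H R} C"
  shows "hom_graph G H (\<Union>C)"
proof -
  interpret GH: group "G \<times>\<times> H"
    by (simp add: DirProd_group G H)
  have R: "subgroup R (G \<times>\<times> H)" "\<And>y. (\<one>\<^bsub>G\<^esub>, y) \<in> R \<Longrightarrow> y = \<one>\<^bsub>H\<^esub>" if "R \<in> C" for R
    using that C unfolding subset.chain_def hom_graph_def by auto
  have "subgroup (\<Union>C) (G \<times>\<times> H)"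
  proof (rule GH.subgroupI)
    show "\<Union>C \<subseteq> carrier (G \<times>\<times> H)"
      using R subgroup.subset by blast
    show "\<Union>C \<noteq> {}"
      using R subgroup.one_closed \<open>C \<noteq> {}\<close> by blast
    show "inv\<^bsub>G \<times>\<times> H\<^esub> a \<in> \<Union>C" if "a \<in> \<Union>C" for a
      using that subgroup.m_inv_closed[OF R(1)] by blast
  next
    fix a b assume "a \<in> \<Union>C" "b \<in> \<Union>C"
    then obtain S T where ST: "S \<in> C" "a \<in> S" "T \<in> C" "b \<in> T"
      by blast
    then have "S \<subseteq> T \<or> T \<subseteq> S"
      using C unfolding subset_chain_def by blast
    then show "a \<otimes>\<^bsub>G \<times>\<times> H\<^esub> b \<in> \<Union>C"
      using ST subgroup.m_closed[OF R(1)[OF ST(1)], of a b] subgroup.m_closed[OF R(1)[OF ST(3)], of a b]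
      by blast
  qed
  then show ?thesis
    using R unfolding hom_graph_def by blast
qed

text \<open>Zorn's lemma: a maximal extension of R is total, because \<open>hom_graph_extend\<close>
  could otherwise adjoin a missing element. Prescribing a graph instead of a map on a subgroup lets
  R be given by any formula whose fibre over the unit is trivial.\<close>

lemma divisible_group_injective:
  assumes G: "comm_group G" and H: "divisible_group H" and R: "hom_graph G H R"
  obtains g where "g \<in> hom G H" "\<And>x y. (x, y) \<in> R \<Longrightarrow> g x = y"
proof -
  have grp: "group G" "group H"
    using G H unfolding divisible_group_def by (auto simp: comm_group_def)
  have "\<exists>M\<in>{S. hom_graph G H S \<and> R \<subseteq> S}. \<forall>X\<in>{S. hom_graph G H S \<and> R \<subseteq> S}. M \<subseteq> X \<longrightarrow> X = M"
  proof (rule subset_Zorn_nonempty)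
    show "{S. hom_graph G H S \<and> R \<subseteq> S} \<noteq> {}"
      using R by blast
  next
    fix C assume C: "C \<noteq> {}" "subset.chain {S. hom_graph G H S \<and> R \<subseteq> S} C"
    have "subset.chain {S. hom_graph G H S} C"
      using C(2) unfolding subset.chain_def by auto
    then have "hom_graph G H (\<Union>C)"
      using hom_graph_Union_chain grp C(1) by blast
    moreover have "R \<subseteq> \<Union>C"
      using C unfolding subset.chain_def by blast
    ultimately show "\<Union>C \<in> {S. hom_graph G H S \<and> R \<subseteq> S}"
      by blast
  qed
  then obtain M where M0: "M \<in> {S. hom_graph G H S \<and> R \<subseteq> S}"
      "\<forall>X\<in>{S. hom_graph G H S \<and> R \<subseteq> S}. M \<subseteq> X \<longrightarrow> X = M"
    by (rule bexE)
  then have M: "hom_graph G H M" "R \<subseteq> M" by auto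
  have maximal: "X = M" if "hom_graph G H X" "M \<subseteq> X" for X
    using M0(2) that M(2) by auto
  have "c \<in> Domain M" if c: "c \<in> carrier G" for c
  proof -
    obtain R' where "hom_graph G H R'" "M \<subseteq> R'" "c \<in> Domain R'"
      using hom_graph_extend[OF G H M(1) c] by blast
    then show ?thesis using maximal by blast
  qed
  moreover have "Domain M \<subseteq> carrier G"
    using M(1) subgroup.subset unfolding hom_graph_def by fastforce
  ultimately have dom: "Domain M = carrier G" by blast
  obtain g where g: "g \<in> hom (G\<lparr>carrier := Domain M\<rparr>) H" "\<And>x y. (x, y) \<in> M \<Longrightarrow> g x = y"
    using hom_graph_hom[OF grp M(1)] by blast
  have "g \<in> hom G H"
    using g(1) dom by simp
  then show ?thesis
    using that g(2) M(2) by blast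
qed

section \<open>Pure subgroups and homomorphisms of bounded exponent\<close>

lemma pure_subset_subgroup: "pure_subset S B \<Longrightarrow> subgroup S B"
  unfolding pure_subset_def by blast

lemma pure_subgroup_eq:
  assumes "pure_subgroup A B"
  shows "carrier A \<subseteq> carrier B" "\<one>\<^bsub>A\<^esub> = \<one>\<^bsub>B\<^esub>"
    and "\<And>x y. x \<in> carrier A \<Longrightarrow> y \<in> carrier A \<Longrightarrow> x \<otimes>\<^bsub>A\<^esub> y = x \<otimes>\<^bsub>B\<^esub> y"
    and "subgroup (carrier A) B"
  using assms unfolding pure_subgroup_def pure_subset_def by (auto dest: subgroup.subset)

text \<open>The records may multiply differently outside \<open>carrier A\<close>, so agreement of
  powers and closure of \<open>carrier A\<close> are carried through the induction together.\<close>

lemma pure_subgroup_pow: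
  assumes "pure_subgroup A B" "x \<in> carrier A"
  shows "x [^]\<^bsub>A\<^esub> (k::nat) = x [^]\<^bsub>B\<^esub> k" "x [^]\<^bsub>B\<^esub> (k::nat) \<in> carrier A"
proof (induction k)
  case 0
  case 1
  show ?case using pure_subgroup_eq[OF assms(1)] by simp
  case 2
  show ?case using pure_subgroup_eq[OF assms(1)] subgroup.one_closed[of "carrier A" B] by simp
next
  case (Suc k)
  case 1
  show ?case using pure_subgroup_eq[OF assms(1)] Suc assms(2) by simp
  case 2
  show ?case using pure_subgroup_eq[OF assms(1)] Suc assms(2) subgroup.m_closed[of "carrier A" B] by simp
qed

lemma pure_subgroup_root:
  assumes "pure_subgroup A B" "a \<in> carrier A" "b \<in> carrier B" "a = b [^]\<^bsub>B\<^esub> k" "(k::nat) \<ge> 1"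
  obtains a' where "a' \<in> carrier A" "a = a' [^]\<^bsub>A\<^esub> k"
  using assms pure_subgroup_pow(1)[OF assms(1)] unfolding pure_subgroup_def pure_subset_def by metis

text \<open>
  Extend \<open>f\<close> by the trivial map on \<open>kC\<close> first: \<open>B \<inter> kC = kB\<close> by purity, and \<open>f\<close> kills \<open>kB\<close>. For
  \<open>k = 0\<close> the exponent condition is void.
\<close>

lemma pure_hom_extend:
  fixes k :: nat
  assumes B: "comm_group B" and C: "comm_group C" and Q: "divisible_group Q"
    and BC: "pure_subgroup B C" and f: "f \<in> hom B Q"
    and fk: "\<And>x. x \<in> carrier B \<Longrightarrow> f x [^]\<^bsub>Q\<^esub> k = \<one>\<^bsub>Q\<^esub>"
  obtains g where "g \<in> hom C Q" "\<And>x. x \<in> carrier B \<Longrightarrow> g x = f x"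
    "\<And>x. x \<in> carrier C \<Longrightarrow> g x [^]\<^bsub>Q\<^esub> k = \<one>\<^bsub>Q\<^esub>"
proof -
  have Q': "comm_group Q"
    using Q unfolding divisible_group_def by blast
  interpret B: comm_group B by fact
  interpret C: comm_group C by fact
  interpret Q: comm_group Q by fact
  interpret CQ: group "C \<times>\<times> Q"
    by (simp add: DirProd_group C.is_group Q.is_group)
  note BC_eq = pure_subgroup_eq[OF BC]
  have fc: "f x \<in> carrier Q" if "x \<in> carrier B" for x
    using that f by (rule hom_in_carrier[rotated])
  have f_one: "f \<one>\<^bsub>C\<^esub> = \<one>\<^bsub>Q\<^esub>"
    using hom_one[OF f] BC_eq(2) by (simp add: B.is_group Q.is_group)
  have f_mult: "f (x \<otimes>\<^bsub>C\<^esub> y) = f x \<otimes>\<^bsub>Q\<^esub> f y" if "x \<in> carrier B" "y \<in> carrier B" for x y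
    using hom_mult[OF f] that BC_eq(3) by metis
  have inv_eq: "inv\<^bsub>C\<^esub> x \<in> carrier B" if "x \<in> carrier B" for x
    using that subgroup.m_inv_closed[OF BC_eq(4)] by blast
  have f_inv: "f (inv\<^bsub>C\<^esub> x) = inv\<^bsub>Q\<^esub> (f x)" if "x \<in> carrier B" for x
  proof (rule Q.inv_equality[symmetric])
    have "f (inv\<^bsub>C\<^esub> x \<otimes>\<^bsub>C\<^esub> x) = f \<one>\<^bsub>C\<^esub>"
      using that BC_eq(1) by (simp add: C.l_inv subset_iff)
    then show "f (inv\<^bsub>C\<^esub> x) \<otimes>\<^bsub>Q\<^esub> f x = \<one>\<^bsub>Q\<^esub>"
      using f_mult[OF inv_eq[OF that] that] f_one by simp
  qed (use fc that inv_eq in auto)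
  define R where "R = {(b \<otimes>\<^bsub>C\<^esub> d [^]\<^bsub>C\<^esub> k, f b) | b d. b \<in> carrier B \<and> d \<in> carrier C}"
  have RI: "(b \<otimes>\<^bsub>C\<^esub> d [^]\<^bsub>C\<^esub> k, f b) \<in> R" if "b \<in> carrier B" "d \<in> carrier C" for b d
    using that unfolding R_def by blast
  have oneB: "\<one>\<^bsub>C\<^esub> \<in> carrier B"
    using BC_eq(2) B.one_closed by simp
  have "subgroup R (C \<times>\<times> Q)"
  proof (rule CQ.subgroupI)
    show "R \<subseteq> carrier (C \<times>\<times> Q)"
      unfolding R_def using BC_eq(1) fc by auto
    show "R \<noteq> {}"
      using RI[OF oneB C.one_closed] by blast
  next
    fix a assume "a \<in> R"
    then obtain b d where a: "a = (b \<otimes>\<^bsub>C\<^esub> d [^]\<^bsub>C\<^esub> k, f b)" "b \<in> carrier B" "d \<in> carrier C"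
      unfolding R_def by blast
    then have b: "b \<in> carrier C" using BC_eq(1) by blast
    have "inv\<^bsub>C \<times>\<times> Q\<^esub> a = (inv\<^bsub>C\<^esub> b \<otimes>\<^bsub>C\<^esub> (inv\<^bsub>C\<^esub> d) [^]\<^bsub>C\<^esub> k, f (inv\<^bsub>C\<^esub> b))"
      using a b fc by (simp add: C.is_group Q.is_group C.inv_mult C.nat_pow_inv f_inv)
    then show "inv\<^bsub>C \<times>\<times> Q\<^esub> a \<in> R"
      using RI[OF inv_eq[OF a(2)] C.inv_closed[OF a(3)]] by simp
  next
    fix a a' assume "a \<in> R" "a' \<in> R"
    then obtain b d b' d' where a: "a = (b \<otimes>\<^bsub>C\<^esub> d [^]\<^bsub>C\<^esub> k, f b)" "b \<in> carrier B" "d \<in> carrier C"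
      and a': "a' = (b' \<otimes>\<^bsub>C\<^esub> d' [^]\<^bsub>C\<^esub> k, f b')" "b' \<in> carrier B" "d' \<in> carrier C"
      unfolding R_def by blast
    have b: "b \<in> carrier C" "b' \<in> carrier C" using a a' BC_eq(1) by blast+
    have "a \<otimes>\<^bsub>C \<times>\<times> Q\<^esub> a' = ((b \<otimes>\<^bsub>C\<^esub> b') \<otimes>\<^bsub>C\<^esub> (d \<otimes>\<^bsub>C\<^esub> d') [^]\<^bsub>C\<^esub> k, f (b \<otimes>\<^bsub>C\<^esub> b'))"
      using a a' b by (simp add: C.nat_pow_distrib f_mult comm_group_mult_swap[OF C])
    then show "a \<otimes>\<^bsub>C \<times>\<times> Q\<^esub> a' \<in> R"
      using RI[OF subgroup.m_closed[OF BC_eq(4) a(2) a'(2)] C.m_closed[OF a(3) a'(3)]] by simp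
  qed
  moreover have "y = \<one>\<^bsub>Q\<^esub>" if "(\<one>\<^bsub>C\<^esub>, y) \<in> R" for y
  proof -
    obtain b d where bd: "\<one>\<^bsub>C\<^esub> = b \<otimes>\<^bsub>C\<^esub> d [^]\<^bsub>C\<^esub> k" "y = f b" "b \<in> carrier B" "d \<in> carrier C"
      using \<open>(\<one>\<^bsub>C\<^esub>, y) \<in> R\<close> unfolding R_def by blast
    have b: "b \<in> carrier C"
      using bd BC_eq(1) by blast
    have beq: "b = (inv\<^bsub>C\<^esub> d) [^]\<^bsub>C\<^esub> k"
      using bd(1,4) b C.inv_equality[of b "d [^]\<^bsub>C\<^esub> k"] by (simp add: C.nat_pow_inv)
    show ?thesis
    proof (cases "k = 0")
      case True
      then have "b = \<one>\<^bsub>C\<^esub>" using beq by simp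
      then show ?thesis using bd(2) f_one by simp
    next
      case False
      then obtain b' where b': "b' \<in> carrier B" "b = b' [^]\<^bsub>B\<^esub> k"
        using pure_subgroup_root[OF BC bd(3) C.inv_closed[OF bd(4)] beq] by auto
      then have "f b = f b' [^]\<^bsub>Q\<^esub> k"
        using hom_nat_pow[OF f b'(1)] B.is_group Q.is_group by simp
      then show ?thesis
        using fk[OF b'(1)] bd(2) by simp
    qed
  qed
  ultimately have "hom_graph C Q R"
    unfolding hom_graph_def by blast
  then obtain g where g: "g \<in> hom C Q" "\<And>x y. (x, y) \<in> R \<Longrightarrow> g x = y"
    using divisible_group_injective[OF C Q] by blast
  have "g x = f x" if "x \<in> carrier B" for x
    using g(2)[OF RI[OF that C.one_closed]] that BC_eq(1) by (auto simp: subset_iff)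
  moreover have "g x [^]\<^bsub>Q\<^esub> k = \<one>\<^bsub>Q\<^esub>" if "x \<in> carrier C" for x
  proof -
    \<comment> \<open>The multiples kx occur in \<open>R\<close> with b the unit, so
      \<open>g\<close> kills kC.\<close>
    have "g (x [^]\<^bsub>C\<^esub> k) = \<one>\<^bsub>Q\<^esub>"
      using g(2)[OF RI[OF oneB that]] that f_one by simp
    then show ?thesis
      using hom_nat_pow[OF g(1) that] C.is_group Q.is_group by simp
  qed
  ultimately show ?thesis using that g(1) by blast
qed


subsection \<open>Co-cyclic groups\<close>

lemma comm_group_subgroup:
  assumes "comm_group G" "subgroup S G"
  shows "comm_group (G\<lparr>carrier := S\<rparr>)"
proof -
  interpret G: comm_group G by fact
  have "group (G\<lparr>carrier := S\<rparr>)"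
    using assms(2) by (rule G.subgroup_imp_group)
  then show ?thesis
    by (rule group.group_comm_groupI) (use subgroup.subset[OF assms(2)] in \<open>auto intro: G.m_comm\<close>)
qed

section \<open>Roots of unity and quasi-cyclic groups\<close>

lemma root_of_unity_pow_cong:
  fixes z :: complex and a b N :: nat
  assumes "z ^ N = 1" "[a = b] (mod N)"
  shows "z ^ a = z ^ b"
proof -
  have *: "z ^ c = z ^ (c mod N)" for c
    by (metis assms(1) div_mult_mod_eq mult.commute mult_1 power_add power_mult power_one)
  show ?thesis
    using *[of a] *[of b] assms(2) unfolding cong_def by simp
qed

text \<open>u is an inverse of k modulo N, so raising to the power k is invertible on N-th roots of
  unity.\<close>

lemma root_of_unity_pow_coprime_inverse:
  fixes z :: complex and k N :: nat
  assumes "coprime k N" "z ^ N = 1"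
  obtains u :: nat where "(z ^ u) ^ k = z" "(z ^ k) ^ u = z"
proof -
  obtain u where "[k * u = 1] (mod N)"
    using cong_solve_coprime_nat[OF assms(1)] by auto
  then have "z ^ (k * u) = z"
    using root_of_unity_pow_cong[OF assms(2)] by fastforce
  then show ?thesis
    using that by (metis mult.commute power_mult)
qed

lemma root_of_unity_nth_root:
  fixes z :: complex and k N :: nat
  assumes "z ^ N = 1" "N > 0" "k > 0"
  obtains w where "w ^ k = z"
proof -
  have "cmod z = 1"
    using power_eq_1_iff[OF assms(1)] assms(2) by auto
  then have "z = cis (Arg z)"
    using cis_Arg[of z] by (metis div_by_1 norm_zero of_real_1 sgn_div_norm scaleR_one inverse_1 zero_neq_one)
  moreover have "cis (Arg z / k) ^ k = cis (Arg z)"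
    using assms(3) by (simp add: DeMoivre)
  ultimately show ?thesis using that by metis
qed

lemma pruefer_group_simps [simp]:
  "carrier (pruefer_group p) = {z. \<exists>n::nat. z ^ (p ^ n) = 1}"
  "x \<otimes>\<^bsub>pruefer_group p\<^esub> y = x * y"
  "\<one>\<^bsub>pruefer_group p\<^esub> = 1"
  by (simp_all add: pruefer_group_def)

lemma pruefer_group_pow [simp]: "x [^]\<^bsub>pruefer_group p\<^esub> (k::nat) = x ^ k"
  by (induction k) auto

lemma comm_group_pruefer:
  assumes "prime p"
  shows "comm_group (pruefer_group p)"
proof (rule comm_groupI)
  have p: "p > 0"
    using assms prime_gt_0_nat by blast
  show "x \<otimes>\<^bsub>pruefer_group p\<^esub> y \<in> carrier (pruefer_group p)"
    if xy: "x \<in> carrier (pruefer_group p)" "y \<in> carrier (pruefer_group p)" for x y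
  proof -
    obtain n m where nm: "x ^ (p ^ n) = 1" "y ^ (p ^ m) = 1"
      using xy by auto
    have "x ^ (p ^ (n + m)) = (x ^ (p ^ n)) ^ (p ^ m)" "y ^ (p ^ (n + m)) = (y ^ (p ^ m)) ^ (p ^ n)"
      by (simp_all add: power_add mult.commute flip: power_mult)
    then have "(x * y) ^ (p ^ (n + m)) = 1"
      using nm by (simp add: power_mult_distrib)
    then show ?thesis by auto
  qed
  show "\<exists>y\<in>carrier (pruefer_group p). y \<otimes>\<^bsub>pruefer_group p\<^esub> x = \<one>\<^bsub>pruefer_group p\<^esub>"
    if x: "x \<in> carrier (pruefer_group p)" for x
  proof -
    obtain n where n: "x ^ (p ^ n) = 1"
      using x by auto
    then have "x \<noteq> 0"
      using p by (metis power_not_zero zero_neq_one power_0_left less_numeral_extra(3) zero_less_power)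
    moreover have "inverse x ^ (p ^ n) = 1"
      using n by (simp add: power_inverse)
    ultimately show ?thesis by (intro bexI[of _ "inverse x"]) auto
  qed
qed (auto simp: mult_ac)

text \<open>Write k = p^a k' with k' prime to p. On p-power roots of unity k' acts invertibly, and a
  complex p^a-th root of a p-power root of unity is again one.\<close>

lemma divisible_group_pruefer:
  assumes p: "prime p"
  shows "divisible_group (pruefer_group p)"
  unfolding divisible_group_def
proof (intro conjI ballI allI impI)
  show "comm_group (pruefer_group p)"
    using p by (rule comm_group_pruefer)
next
  fix x and k :: nat
  assume "x \<in> carrier (pruefer_group p)" and k: "1 \<le> k"
  then obtain n where n: "x ^ (p ^ n) = 1"
    by auto
  obtain a k' where k': "k = p ^ a * k'" "\<not> p dvd k'"
    using multiplicity_decompose'[of k p] k p by (metis not_one_le_zero not_prime_unit)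
  then have "coprime k' (p ^ n)"
    using p by (meson coprime_commute coprime_power_right_iff prime_imp_coprime)
  then obtain u where u: "(x ^ u) ^ k' = x"
    using root_of_unity_pow_coprime_inverse n by blast
  have un: "(x ^ u) ^ (p ^ n) = 1"
    using n by (metis mult.commute power_mult power_one)
  then obtain w where w: "w ^ (p ^ a) = x ^ u"
    using root_of_unity_nth_root[of "x ^ u" "p ^ n" "p ^ a"] prime_gt_0_nat[OF p] by auto
  have "w ^ (p ^ (a + n)) = 1"
    using w un by (simp add: power_add power_mult)
  moreover have "w ^ k = x"
    using w u by (simp add: k' power_mult)
  ultimately show "\<exists>y\<in>carrier (pruefer_group p). y [^]\<^bsub>pruefer_group p\<^esub> k = x"
    by auto
qed

text \<open>The part of k prime to p acts invertibly on p-power roots of unity, so only the p-part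
  of k can annihilate z. This is what places k-torsion in a finite co-cyclic group.\<close>

lemma pruefer_group_pow_multiplicity:
  assumes p: "prime p" and z: "z \<in> carrier (pruefer_group p)" "z ^ k = 1" and k: "k > 0"
  shows "z ^ (p ^ multiplicity p k) = 1"
proof -
  obtain n where n: "z ^ (p ^ n) = 1"
    using z by auto
  obtain k' where k': "k = p ^ multiplicity p k * k'" "\<not> p dvd k'"
    using multiplicity_decompose'[of k p] k p by (metis not_prime_unit less_numeral_extra(3))
  have "coprime k' (p ^ n)"
    using p k'(2) by (meson coprime_commute coprime_power_right_iff prime_imp_coprime)
  moreover have "(z ^ (p ^ multiplicity p k)) ^ (p ^ n) = 1"
    using n by (metis mult.commute power_mult power_one)
  ultimately obtain u where "((z ^ (p ^ multiplicity p k)) ^ k') ^ u = z ^ (p ^ multiplicity p k)"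
    using root_of_unity_pow_coprime_inverse by blast
  moreover have "(z ^ (p ^ multiplicity p k)) ^ k' = 1"
    using z(2) k'(1) by (metis power_mult)
  ultimately show ?thesis by simp
qed

text \<open>Prescribe 1 on N and a suitable w at c, then extend by injectivity of the quasi-cyclic
  group. The order of c modulo N dictates p and w: if it is finite, p is a prime divisor of it and w
  a p-th root of unity other than 1; if it is infinite, nothing constrains w.\<close>

lemma separating_hom:
  fixes C :: "'a monoid"
  assumes C: "comm_group C" and N: "subgroup N C" and c: "c \<in> carrier C" "c \<notin> N"
  obtains p \<phi> where "prime p" "\<phi> \<in> hom C (pruefer_group p)" "\<And>x. x \<in> N \<Longrightarrow> \<phi> x = 1" "\<phi> c \<noteq> 1"
proof -
  interpret C: comm_group C by fact
  have graph: "hom_graph C (pruefer_group p) (N \<times> {1})" if "prime p" for p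
  proof -
    have "subgroup {\<one>\<^bsub>pruefer_group p\<^esub>} (pruefer_group p)"
      by (rule group.triv_subgroup) (use comm_group_pruefer[OF that] in \<open>simp add: comm_group_def\<close>)
    then show ?thesis
      using DirProd_subgroups[OF C.is_group N, of "pruefer_group p" "{1}"] comm_group_pruefer[OF that]
      unfolding hom_graph_def by (auto simp: comm_group_def)
  qed
  have "\<exists>p w. prime p \<and> w \<in> carrier (pruefer_group p) \<and> w \<noteq> 1 \<and>
      (\<forall>(j::int) y. (c [^]\<^bsub>C\<^esub> j, y) \<in> N \<times> {1} \<longrightarrow> y = w [^]\<^bsub>pruefer_group p\<^esub> j)"
  proof (cases "\<exists>n::nat. n > 0 \<and> c [^]\<^bsub>C\<^esub> n \<in> N")
    case True
    then obtain d :: nat where d: "d > 0" "c [^]\<^bsub>C\<^esub> d \<in> N"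
      "\<And>n. n < d \<Longrightarrow> \<not> (n > 0 \<and> c [^]\<^bsub>C\<^esub> n \<in> N)"
      using exists_least_iff[of "\<lambda>n. n > 0 \<and> c [^]\<^bsub>C\<^esub> n \<in> N"] by blast
    have "d \<noteq> 1"
      using d(2) c by (cases "d = 1") auto
    then obtain p where p: "prime p" "p dvd d"
      using prime_factor_nat by blast
    define w where "w = cis (2 * pi / p)"
    have p2: "p \<ge> 2"
      using p prime_ge_2_nat by blast
    have wp: "w ^ p = 1"
      using p2 by (simp add: w_def DeMoivre)
    have "w \<noteq> 1"
    proof
      assume "w = 1"
      then have "cos (2 * pi / p) = 1"
        by (simp add: w_def complex_eq_iff)
      \<comment> \<open>The angle 2 pi / p is positive and at most pi because p \<ge> 2, and the
        cosine is strictly decreasing on that range.\<close>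
      moreover have "cos (2 * pi / p) < cos 0"
      proof (rule cos_monotone_0_pi)
        have "2 * pi \<le> real p * pi"
          using p2 by simp
        then show "2 * pi / real p \<le> pi"
          using p2 by (simp add: field_simps)
      qed (use p2 in auto)
      ultimately show False by simp
    qed
    moreover have "w \<in> carrier (pruefer_group p)"
      using wp by (auto intro: exI[of _ 1])
    \<comment> \<open>As p divides d, this agrees with the value 1 prescribed at \<open>c^d\<close>,
      which lies in N.\<close>
    moreover have "w ^ d = 1"
      using p(2) wp by (metis dvdE power_mult power_one)
    then have "y = w [^]\<^bsub>pruefer_group p\<^esub> j" if "(c [^]\<^bsub>C\<^esub> j, y) \<in> N \<times> {1}" for j :: int and y
      using hom_graph_Domain_pow[OF C.is_group _ graph[OF p(1)] c(1) _ d(1) \<open>w \<in> carrier (pruefer_group p)\<close> _ that]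
        comm_group_pruefer[OF p(1)] d by (auto simp: comm_group_def)
    ultimately show ?thesis using p(1) by blast
  next
    case False
    \<comment> \<open>No positive multiple of c lies in N, so any non-trivial value will do; -1 with
      p = 2 is the simplest.\<close>
    have "(-1::complex) ^ (2 ^ 1) = 1" by simp
    then have w: "-1 \<in> carrier (pruefer_group 2)"
      unfolding pruefer_group_simps by blast
    have free: "c [^]\<^bsub>C\<^esub> n \<notin> Domain (N \<times> {1::complex})" if "0 < n" for n :: nat
      using False that by blast
    have "group (pruefer_group 2)"
      using comm_group_pruefer[OF two_is_prime_nat] by (simp add: comm_group_def)
    then have "\<forall>(j::int) y. (c [^]\<^bsub>C\<^esub> j, y) \<in> N \<times> {1} \<longrightarrow> y = (-1) [^]\<^bsub>pruefer_group 2\<^esub> j"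
      using hom_graph_Domain_pow_free[OF C.is_group _ graph[OF two_is_prime_nat] c(1) free] by blast
    moreover have "(-1::complex) \<noteq> 1" by simp
    ultimately show ?thesis using w two_is_prime_nat by blast
  qed
  then obtain p w where p: "prime p" and w: "w \<in> carrier (pruefer_group p)" "w \<noteq> 1"
    and cw: "\<And>(j::int) y. (c [^]\<^bsub>C\<^esub> j, y) \<in> N \<times> {1} \<Longrightarrow> y = w [^]\<^bsub>pruefer_group p\<^esub> j"
    by blast
  obtain R where R: "hom_graph C (pruefer_group p) R" "N \<times> {1} \<subseteq> R" "(c, w) \<in> R"
    by (rule hom_graph_insert[OF C comm_group_pruefer[OF p] graph[OF p] c(1) w(1) cw])
  obtain \<phi> where \<phi>: "\<phi> \<in> hom C (pruefer_group p)" "\<And>x y. (x, y) \<in> R \<Longrightarrow> \<phi> x = y"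
    using divisible_group_injective[OF C divisible_group_pruefer[OF p] R(1)] by blast
  show ?thesis
  proof (rule that[OF p \<phi>(1)])
    show "\<phi> x = 1" if "x \<in> N" for x
      using \<phi>(2) R(2) that by blast
    show "\<phi> c \<noteq> 1"
      using \<phi>(2)[OF R(3)] w(2) by simp
  qed
qed

text \<open>A uniform model of the co-cyclic p-groups as torsion subgroups of one divisible group: a
  homomorphism into the model is a homomorphism into \<open>pruefer_group p\<close> subject to the
  exponent condition of \<open>pure_hom_extend\<close>.\<close>

definition roots_group :: "nat \<Rightarrow> nat \<Rightarrow> complex monoid" where
  "roots_group p k = (pruefer_group p)\<lparr>carrier := {z \<in> carrier (pruefer_group p). z ^ k = 1}\<rparr>"

text \<open>
  The exponent \<open>0\<close> imposes no condition on a root of unity, so it stands for the type \<open>\<infinity>\<close>.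
\<close>

definition cocyclic_exponent :: "nat \<Rightarrow> enat \<Rightarrow> nat" where
  "cocyclic_exponent p n = (case n of enat m \<Rightarrow> p ^ m | \<infinity> \<Rightarrow> 0)"

lemma roots_group_simps [simp]:
  "carrier (roots_group p k) = {z \<in> carrier (pruefer_group p). z ^ k = 1}"
  "x \<otimes>\<^bsub>roots_group p k\<^esub> y = x * y"
  "\<one>\<^bsub>roots_group p k\<^esub> = 1"
  by (simp_all add: roots_group_def)

lemma roots_group_pow [simp]: "x [^]\<^bsub>roots_group p k\<^esub> (j::nat) = x ^ j"
  by (induction j) auto

lemma comm_group_roots:
  assumes "prime p"
  shows "comm_group (roots_group p k)"
proof -
  interpret P: comm_group "pruefer_group p"
    using assms by (rule comm_group_pruefer)
  have "subgroup {z \<in> carrier (pruefer_group p). z ^ k = 1} (pruefer_group p)"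
  proof (rule P.subgroupI)
    show "{z \<in> carrier (pruefer_group p). z ^ k = 1} \<noteq> {}"
      using P.one_closed by (metis (mono_tags, lifting) empty_Collect_eq power_one pruefer_group_simps(3))
    show "inv\<^bsub>pruefer_group p\<^esub> a \<in> {z \<in> carrier (pruefer_group p). z ^ k = 1}"
      if "a \<in> {z \<in> carrier (pruefer_group p). z ^ k = 1}" for a
      using that P.nat_pow_inv[of a k] P.inv_closed[of a] P.inv_one
      unfolding pruefer_group_pow pruefer_group_simps(3) by auto
    show "a \<otimes>\<^bsub>pruefer_group p\<^esub> b \<in> {z \<in> carrier (pruefer_group p). z ^ k = 1}"
      if "a \<in> {z \<in> carrier (pruefer_group p). z ^ k = 1}" "b \<in> {z \<in> carrier (pruefer_group p). z ^ k = 1}" for a b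
      using that P.m_closed[of a b] by (auto simp: power_mult_distrib simp del: pruefer_group_simps(1))
  qed auto
  then show ?thesis
    unfolding roots_group_def by (rule comm_group_subgroup[OF P.comm_group_axioms])
qed

text \<open>The isomorphism is the exponential map sending j to the complex number of argument 2 pi
  j / N, where N = p^m. Every N-th root of unity is a p-power root, so the carrier of the model is
  the full set of N-th roots.\<close>

lemma roots_group_iso_integer_mod_group:
  assumes "prime p"
  shows "integer_mod_group (p ^ m) \<cong> roots_group p (p ^ m)"
proof -
  define N where "N = p ^ m"
  have N: "N > 0"
    using assms prime_gt_0_nat by (simp add: N_def)
  define f where "f k = cis (2 * pi * real_of_int k / N)" for k :: int
  have f_add: "f (x + y) = f x * f y" for x y
    by (simp add: f_def cis_mult add_divide_distrib distrib_left)
  have f_mod: "f (x mod int N) = f x" for x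
  proof -
    have "f (int N * (x div int N)) = 1"
      using N cis_multiple_2pi[of "real_of_int (x div int N)"] by (simp add: f_def mult.assoc)
    then show ?thesis
      using f_add[of "int N * (x div int N)" "x mod int N"] by simp
  qed
  have carr: "carrier (roots_group p N) = {z. z ^ N = 1}"
    by (auto simp: N_def)
  have "bij_betw f {0..<int N} {z. z ^ N = 1}"
  proof -
    have "bij_betw nat {0..<int N} {..<N}"
      by (rule bij_betwI[of _ _ _ int]) auto
    from bij_betw_trans[OF this bij_betw_roots_unity[OF N]]
    show ?thesis
      by (rule iffD1[OF bij_betw_cong, rotated]) (simp add: f_def)
  qed
  then have "f \<in> iso (integer_mod_group N) (roots_group p N)"
    using N by (auto simp: iso_def hom_def carr carrier_integer_mod_group f_mod f_add bij_betw_def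
        simp del: roots_group_simps(1))
  then show ?thesis
    unfolding N_def is_iso_def by blast
qed

text \<open>Merges the finite and the infinite types into one model, so that later arguments only
  see the exponent.\<close>

lemma cocyclic_of_type_iff:
  assumes p: "prime p"
  shows "cocyclic_of_type p n G \<longleftrightarrow> comm_group G \<and> G \<cong> roots_group p (cocyclic_exponent p n)"
proof (cases n)
  case (enat m)
  have iso: "integer_mod_group (p ^ m) \<cong> roots_group p (p ^ m)"
    using p by (rule roots_group_iso_integer_mod_group)
  then have "roots_group p (p ^ m) \<cong> integer_mod_group (p ^ m)"
    by (simp add: group.iso_sym)
  with iso show ?thesis
    using enat by (auto simp: cocyclic_of_type_def cocyclic_exponent_def intro: iso_trans)
next
  case infinity
  have "roots_group p 0 = pruefer_group p"
    by (simp add: roots_group_def pruefer_group_def)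
  then show ?thesis
    using infinity by (simp add: cocyclic_of_type_def cocyclic_exponent_def)
qed

lemma cocyclic_of_type_isoE:
  assumes "prime p" "cocyclic_of_type p n G"
  obtains \<iota> where "\<iota> \<in> iso G (roots_group p (cocyclic_exponent p n))"
    "inv_into (carrier G) \<iota> \<in> iso (roots_group p (cocyclic_exponent p n)) G"
proof -
  have G: "group G" "G \<cong> roots_group p (cocyclic_exponent p n)"
    using assms by (auto simp: cocyclic_of_type_iff comm_group_def)
  then obtain \<iota> where "\<iota> \<in> iso G (roots_group p (cocyclic_exponent p n))"
    unfolding is_iso_def by blast
  then show ?thesis
    using that group.iso_set_sym[OF G(1)] by blast
qed

lemma hom_roots_group_iff:
  "f \<in> hom C (roots_group p k) \<longleftrightarrow> f \<in> hom C (pruefer_group p) \<and> (\<forall>x\<in>carrier C. f x ^ k = 1)"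
  by (auto simp: hom_def)

text \<open>Algebraic compactness of co-cyclic groups. Inside the quasi-cyclic group, membership in
  the model is the exponent condition that \<open>pure_hom_extend\<close> preserves, so the
  extension lands in the same co-cyclic group.\<close>

lemma cocyclic_hom_extend:
  assumes p: "prime p" and G: "cocyclic_of_type p n G"
    and B: "comm_group B" and C: "comm_group C"
    and BC: "pure_subgroup B C" and f: "f \<in> hom B G"
  obtains g where "g \<in> hom C G" "\<And>x. x \<in> carrier B \<Longrightarrow> g x = f x"
proof -
  obtain \<iota> where \<iota>: "\<iota> \<in> iso G (roots_group p (cocyclic_exponent p n))"
    "inv_into (carrier G) \<iota> \<in> iso (roots_group p (cocyclic_exponent p n)) G"
    by (rule cocyclic_of_type_isoE[OF p G])
  have "\<iota> \<circ> f \<in> hom B (roots_group p (cocyclic_exponent p n))"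
    using hom_compose[OF f, of \<iota>] \<iota>(1) unfolding iso_def by blast
  then have h: "\<iota> \<circ> f \<in> hom B (pruefer_group p)"
    "\<And>x. x \<in> carrier B \<Longrightarrow> (\<iota> \<circ> f) x [^]\<^bsub>pruefer_group p\<^esub> cocyclic_exponent p n = \<one>\<^bsub>pruefer_group p\<^esub>"
    unfolding hom_roots_group_iff by simp_all
  obtain g where g: "g \<in> hom C (pruefer_group p)" "\<And>x. x \<in> carrier B \<Longrightarrow> g x = (\<iota> \<circ> f) x"
    "\<And>x. x \<in> carrier C \<Longrightarrow> g x [^]\<^bsub>pruefer_group p\<^esub> cocyclic_exponent p n = \<one>\<^bsub>pruefer_group p\<^esub>"
    using pure_hom_extend[OF B C divisible_group_pruefer[OF p] BC h] by blast
  then have "g \<in> hom C (roots_group p (cocyclic_exponent p n))"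
    unfolding hom_roots_group_iff by simp
  then have "inv_into (carrier G) \<iota> \<circ> g \<in> hom C G"
    using hom_compose \<iota>(2) by (auto simp: iso_def)
  moreover have "(inv_into (carrier G) \<iota> \<circ> g) x = f x" if "x \<in> carrier B" for x
    using g(2)[OF that] hom_in_carrier[OF f that] \<iota>(1) by (simp add: iso_def bij_betw_def)
  ultimately show ?thesis using that by blast
qed

text \<open>For n = \<infinity> the exponent is 0, which divides only k = 0, so the infinite type
  requires no separate treatment.\<close>

lemma cocyclic_exponent_pow:
  assumes p: "prime p" and G: "cocyclic_of_type p n G" and y: "y \<in> carrier G"
    and k: "cocyclic_exponent p n dvd k"
  shows "y [^]\<^bsub>G\<^esub> k = \<one>\<^bsub>G\<^esub>"
proof -
  obtain \<iota> where \<iota>: "\<iota> \<in> iso G (roots_group p (cocyclic_exponent p n))"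
    by (rule cocyclic_of_type_isoE[OF p G])
  have G': "group G" "group (roots_group p (cocyclic_exponent p n))"
    using G comm_group_roots[OF p] unfolding cocyclic_of_type_def by (auto simp: comm_group_def)
  have h: "\<iota> \<in> hom G (roots_group p (cocyclic_exponent p n))"
    using \<iota> by (simp add: iso_def)
  have "\<iota> y ^ cocyclic_exponent p n = 1"
    using hom_in_carrier[OF h y] by simp
  then have "\<iota> (y [^]\<^bsub>G\<^esub> k) = 1"
    using hom_nat_pow[OF h y G'] k by (metis dvdE power_mult power_one roots_group_pow)
  also have "1 = \<iota> \<one>\<^bsub>G\<^esub>"
    using hom_one[OF h G'] by simp
  finally show ?thesis
    using \<iota> y G'(1) unfolding iso_def bij_betw_def
    by (auto dest!: inj_onD simp: group.is_monoid monoid.nat_pow_closed)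
qed

text \<open>Separate c from N = S + kC. The separating map kills kC, so its values are k-torsion in
  a quasi-cyclic group; for k \<ge> 1 they lie in the co-cyclic group of order p^v, where v is the
  multiplicity of p in k. The conclusions range over all G of the type because a concrete coordinate
  is selected only after p and n are known.\<close>

lemma cocyclic_separation:
  fixes C :: "'a monoid" and k :: nat
  assumes C: "comm_group C" and S: "subgroup S C" and c: "c \<in> carrier C"
    and cS: "\<And>b d. b \<in> S \<Longrightarrow> d \<in> carrier C \<Longrightarrow> c \<noteq> b \<otimes>\<^bsub>C\<^esub> d [^]\<^bsub>C\<^esub> k"
  obtains p n where "prime p"
    "\<And>G :: 'g monoid. cocyclic_of_type p n G \<Longrightarrow>
       (\<exists>\<phi>\<in>hom C G. (\<forall>x\<in>S. \<phi> x = \<one>\<^bsub>G\<^esub>) \<and> \<phi> c \<noteq> \<one>\<^bsub>G\<^esub>)"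
    "\<And>(G :: 'g monoid) y. cocyclic_of_type p n G \<Longrightarrow> k \<ge> 1 \<Longrightarrow> y \<in> carrier G \<Longrightarrow> y [^]\<^bsub>G\<^esub> k = \<one>\<^bsub>G\<^esub>"
proof -
  interpret C: comm_group C by fact
  define N where "N = {b \<otimes>\<^bsub>C\<^esub> d [^]\<^bsub>C\<^esub> k | b d. b \<in> S \<and> d \<in> carrier C}"
  have NI: "b \<otimes>\<^bsub>C\<^esub> d [^]\<^bsub>C\<^esub> k \<in> N" if "b \<in> S" "d \<in> carrier C" for b d
    using that unfolding N_def by blast
  have SC: "b \<in> carrier C" if "b \<in> S" for b
    using subgroup.subset[OF S] that by blast
  have one: "\<one>\<^bsub>C\<^esub> \<in> S"
    using subgroup.one_closed[OF S] .
  have "subgroup N C"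
  proof (rule C.subgroupI)
    show "N \<subseteq> carrier C"
      unfolding N_def using SC by auto
    show "N \<noteq> {}"
      using NI[OF one C.one_closed] by blast
  next
    fix a assume "a \<in> N"
    then obtain b d where a: "a = b \<otimes>\<^bsub>C\<^esub> d [^]\<^bsub>C\<^esub> k" "b \<in> S" "d \<in> carrier C"
      unfolding N_def by blast
    then have "inv\<^bsub>C\<^esub> a = inv\<^bsub>C\<^esub> b \<otimes>\<^bsub>C\<^esub> (inv\<^bsub>C\<^esub> d) [^]\<^bsub>C\<^esub> k"
      using SC by (simp add: C.inv_mult C.nat_pow_inv)
    then show "inv\<^bsub>C\<^esub> a \<in> N"
      using NI[OF subgroup.m_inv_closed[OF S a(2)] C.inv_closed[OF a(3)]] by simp
  next
    fix a a' assume "a \<in> N" "a' \<in> N"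
    then obtain b d b' d' where a: "a = b \<otimes>\<^bsub>C\<^esub> d [^]\<^bsub>C\<^esub> k" "b \<in> S" "d \<in> carrier C"
      and a': "a' = b' \<otimes>\<^bsub>C\<^esub> d' [^]\<^bsub>C\<^esub> k" "b' \<in> S" "d' \<in> carrier C"
      unfolding N_def by blast
    then have "a \<otimes>\<^bsub>C\<^esub> a' = (b \<otimes>\<^bsub>C\<^esub> b') \<otimes>\<^bsub>C\<^esub> (d \<otimes>\<^bsub>C\<^esub> d') [^]\<^bsub>C\<^esub> k"
      using SC by (simp add: C.nat_pow_distrib comm_group_mult_swap[OF C])
    then show "a \<otimes>\<^bsub>C\<^esub> a' \<in> N"
      using NI[OF subgroup.m_closed[OF S a(2) a'(2)] C.m_closed[OF a(3) a'(3)]] by simp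
  qed
  moreover have "c \<notin> N"
    using cS unfolding N_def by blast
  ultimately obtain p \<phi> where p: "prime p" and \<phi>: "\<phi> \<in> hom C (pruefer_group p)"
    "\<And>x. x \<in> N \<Longrightarrow> \<phi> x = 1" "\<phi> c \<noteq> 1"
    using separating_hom[OF C _ c] by metis
  \<comment> \<open>For k = 0 the values satisfy no exponent bound, hence the infinite type.\<close>
  define n where "n = (if k = 0 then \<infinity> else enat (multiplicity p k))"
  have pow: "\<phi> x ^ k = 1" if x: "x \<in> carrier C" for x
  proof -
    have "\<phi> (x [^]\<^bsub>C\<^esub> k) = 1"
      using \<phi>(2)[OF NI[OF one x]] x by simp
    then show ?thesis
      using hom_nat_pow[OF \<phi>(1) x C.is_group] comm_group_pruefer[OF p] by (simp add: comm_group_def)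
  qed
  have "\<phi> x ^ cocyclic_exponent p n = 1" if "x \<in> carrier C" for x
    using pow[OF that] pruefer_group_pow_multiplicity[OF p hom_in_carrier[OF \<phi>(1) that], of k]
    by (simp add: n_def cocyclic_exponent_def)
  then have \<phi>': "\<phi> \<in> hom C (roots_group p (cocyclic_exponent p n))"
    using \<phi>(1) unfolding hom_roots_group_iff by blast
  have S1: "\<phi> x = 1" if "x \<in> S" for x
    using \<phi>(2)[OF NI[OF that C.one_closed]] SC[OF that] by simp
  show ?thesis
  proof (rule that[OF p])
    fix G :: "'g monoid" assume G: "cocyclic_of_type p n G"
    obtain \<iota> where \<iota>: "\<iota> \<in> iso G (roots_group p (cocyclic_exponent p n))"
      "inv_into (carrier G) \<iota> \<in> iso (roots_group p (cocyclic_exponent p n)) G"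
      by (rule cocyclic_of_type_isoE[OF p G])
    define \<psi> where "\<psi> = inv_into (carrier G) \<iota>"
    have grp: "group G" "group (roots_group p (cocyclic_exponent p n))"
      using G comm_group_roots[OF p] unfolding cocyclic_of_type_def by (auto simp: comm_group_def)
    have \<psi>: "\<psi> \<in> hom (roots_group p (cocyclic_exponent p n)) G"
      "inj_on \<psi> (carrier (roots_group p (cocyclic_exponent p n)))"
      using \<iota>(2) unfolding \<psi>_def iso_def bij_betw_def by auto
    have \<psi>1: "\<psi> 1 = \<one>\<^bsub>G\<^esub>"
      using hom_one[OF \<psi>(1) grp(2,1)] by simp
    have "\<psi> \<circ> \<phi> \<in> hom C G"
      using hom_compose[OF \<phi>' \<psi>(1)] .
    moreover have "(\<psi> \<circ> \<phi>) x = \<one>\<^bsub>G\<^esub>" if "x \<in> S" for x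
      using S1[OF that] \<psi>1 by simp
    moreover have "(\<psi> \<circ> \<phi>) c \<noteq> \<one>\<^bsub>G\<^esub>"
    proof
      assume "(\<psi> \<circ> \<phi>) c = \<one>\<^bsub>G\<^esub>"
      then have "\<psi> (\<phi> c) = \<psi> 1"
        using \<psi>1 by simp
      moreover have "1 \<in> carrier (roots_group p (cocyclic_exponent p n))"
        by auto
      ultimately show False
        using inj_onD[OF \<psi>(2) _ hom_in_carrier[OF \<phi>' c]] \<phi>(3) by blast
    qed
    ultimately show "\<exists>\<phi>\<in>hom C G. (\<forall>x\<in>S. \<phi> x = \<one>\<^bsub>G\<^esub>) \<and> \<phi> c \<noteq> \<one>\<^bsub>G\<^esub>"
      by blast
  next
    fix G :: "'g monoid" and y assume G: "cocyclic_of_type p n G" and k: "k \<ge> 1" and y: "y \<in> carrier G"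
    have "cocyclic_exponent p n dvd k"
      using k multiplicity_dvd by (simp add: n_def cocyclic_exponent_def)
    then show "y [^]\<^bsub>G\<^esub> k = \<one>\<^bsub>G\<^esub>"
      using cocyclic_exponent_pow[OF p G y] by blast
  qed
qed


subsection \<open>Pure embeddings and back-and-forth\<close>

text \<open>Injectivity lets purity of the image be tested on A itself: roots of f a inside the
  image correspond to roots of a.\<close>

lemma pure_embedding_iff:
  assumes A: "group A" and B: "group B"
  shows "pure_embedding f A B \<longleftrightarrow> f \<in> hom A B \<and> inj_on f (carrier A) \<and>
    (\<forall>a\<in>carrier A. \<forall>k::nat. k \<ge> 1 \<longrightarrow> (\<exists>b\<in>carrier B. f a = b [^]\<^bsub>B\<^esub> k) \<longrightarrow>
       (\<exists>a'\<in>carrier A. a = a' [^]\<^bsub>A\<^esub> k))"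
    (is "_ \<longleftrightarrow> ?hom \<and> ?inj \<and> ?pure")
proof (cases "?hom \<and> ?inj")
  case True
  then have f: "f \<in> hom A B" "inj_on f (carrier A)" by auto
  interpret f: group_hom A B f
    using A B f(1) by (simp add: group_hom_def group_hom_axioms_def)
  have pow: "f a = f a' [^]\<^bsub>B\<^esub> k \<longleftrightarrow> a = a' [^]\<^bsub>A\<^esub> k"
    if "a \<in> carrier A" "a' \<in> carrier A" for a a' and k :: nat
    using that f.hom_nat_pow[of a' k] inj_onD[OF f(2), of a "a' [^]\<^bsub>A\<^esub> k"] by auto
  have "(\<forall>x\<in>f ` carrier A. \<forall>k::nat. k \<ge> 1 \<longrightarrow>
        (\<exists>b\<in>carrier B. x = b [^]\<^bsub>B\<^esub> k) \<longrightarrow> (\<exists>a'\<in>f ` carrier A. x = a' [^]\<^bsub>B\<^esub> k)) \<longleftrightarrow> ?pure"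
    by (simp add: pow cong: ball_cong bex_cong)
  then show ?thesis
    using f f.img_is_subgroup unfolding pure_embedding_def pure_subset_def by blast
next
  case False
  then show ?thesis unfolding pure_embedding_def by blast
qed

lemma pure_embedding_hom: "pure_embedding f A B \<Longrightarrow> f \<in> hom A B"
  and pure_embedding_inj_on: "pure_embedding f A B \<Longrightarrow> inj_on f (carrier A)"
  and pure_embedding_image: "pure_embedding f A B \<Longrightarrow> pure_subset (f ` carrier A) B"
  unfolding pure_embedding_def by auto

lemma pure_embedding_compose:
  assumes "group A" "group B" "group C" "pure_embedding f A B" "pure_embedding g B C"
  shows "pure_embedding (g \<circ> f) A C"
proof -
  have f: "f \<in> hom A B" "inj_on f (carrier A)"
    and f': "\<And>a k. a \<in> carrier A \<Longrightarrow> (k::nat) \<ge> 1 \<Longrightarrow> \<exists>b\<in>carrier B. f a = b [^]\<^bsub>B\<^esub> k \<Longrightarrow>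
        \<exists>a'\<in>carrier A. a = a' [^]\<^bsub>A\<^esub> k"
    using assms(4) unfolding pure_embedding_iff[OF assms(1,2)] by blast+
  have g: "g \<in> hom B C" "inj_on g (carrier B)"
    and g': "\<And>a k. a \<in> carrier B \<Longrightarrow> (k::nat) \<ge> 1 \<Longrightarrow> \<exists>b\<in>carrier C. g a = b [^]\<^bsub>C\<^esub> k \<Longrightarrow>
        \<exists>a'\<in>carrier B. a = a' [^]\<^bsub>B\<^esub> k"
    using assms(5) unfolding pure_embedding_iff[OF assms(2,3)] by blast+
  have fB: "f ` carrier A \<subseteq> carrier B"
    using f(1) by (rule hom_carrier)
  have "\<exists>a'\<in>carrier A. a = a' [^]\<^bsub>A\<^esub> k"
    if "a \<in> carrier A" "k \<ge> 1" "\<exists>b\<in>carrier C. (g \<circ> f) a = b [^]\<^bsub>C\<^esub> k" for a and k :: nat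
    by (rule f'[OF that(1,2)], rule g'[OF _ that(2)]) (use that fB in auto)
  moreover have "g \<circ> f \<in> hom A C"
    using f(1) g(1) by (rule hom_compose)
  moreover have "inj_on (g \<circ> f) (carrier A)"
    using f(2) inj_on_subset[OF g(2) fB] by (rule comp_inj_on)
  ultimately show ?thesis
    unfolding pure_embedding_iff[OF assms(1,3)] by blast
qed

lemma iso_imp_pure_embedding:
  assumes "group A" "group B" "f \<in> iso A B"
  shows "pure_embedding f A B"
proof -
  have f: "f \<in> hom A B" "inj_on f (carrier A)" "f ` carrier A = carrier B"
    using assms(3) by (auto simp: iso_def bij_betw_def)
  have "pure_subset (carrier B) B"
    using group.subgroup_self[OF assms(2)] by (auto simp: pure_subset_def)
  then show ?thesis
    unfolding pure_embedding_def using f by simp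
qed

lemma pure_subgroup_imp_pure_embedding:
  assumes "pure_subgroup A B"
  shows "pure_embedding (\<lambda>x. x) A B"
  using assms pure_subgroup_eq[OF assms]
  unfolding pure_embedding_def pure_subgroup_def by (auto simp: hom_def)

lemma pure_subgroup_restrict:
  assumes "pure_subset S B"
  shows "pure_subgroup (B\<lparr>carrier := S\<rparr>) B"
  using assms by (simp add: pure_subgroup_def)

lemma pow_restrict_carrier [simp]: "x [^]\<^bsub>G\<lparr>carrier := S\<rparr>\<^esub> (k::nat) = x [^]\<^bsub>G\<^esub> k"
  by (induction k) auto

lemma pure_subset_restrict:
  assumes B: "group B" and S: "pure_subset S B" and T: "subgroup T B" and ST: "S \<subseteq> T"
  shows "pure_subset S (B\<lparr>carrier := T\<rparr>)"
proof -
  have "subgroup S (B\<lparr>carrier := T\<rparr>)"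
    using group.subgroup_incl[OF B _ T ST] S unfolding pure_subset_def by blast
  moreover have "\<exists>a'\<in>S. a = a' [^]\<^bsub>B\<^esub> k"
    if "a \<in> S" "k \<ge> 1" "\<exists>b\<in>T. a = b [^]\<^bsub>B\<^esub> k" for a and k :: nat
    using that S subgroup.subset[OF T] unfolding pure_subset_def by blast
  ultimately show ?thesis
    unfolding pure_subset_def by simp
qed

lemma comm_group_pure_subgroup:
  assumes B: "comm_group B" and AB: "pure_subgroup A B"
  shows "comm_group A"
proof -
  interpret B: comm_group B by fact
  note eq = pure_subgroup_eq[OF AB]
  note sub = subgroup.m_closed[OF eq(4)] subgroup.one_closed[OF eq(4)]
  show ?thesis
  proof (rule comm_groupI)
    show "\<exists>y\<in>carrier A. y \<otimes>\<^bsub>A\<^esub> x = \<one>\<^bsub>A\<^esub>" if "x \<in> carrier A" for x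
      using that eq subgroup.m_inv_closed[OF eq(4) that] by (intro bexI[of _ "inv\<^bsub>B\<^esub> x"]) (auto simp: B.l_inv subset_iff)
  qed (use sub eq in \<open>auto simp: subset_iff B.m_ac\<close>)
qed

lemma comm_group_image_group:
  assumes G: "comm_group G" and j: "inj_on j (carrier G)"
  shows "comm_group (image_group j G)" "j \<in> iso G (image_group j G)"
proof -
  interpret G: comm_group G by fact
  show iso: "j \<in> iso G (image_group j G)"
    using j by (auto simp: iso_def hom_def bij_betw_def image_group_def)
  have "(image_group j G)\<lparr>one := j \<one>\<^bsub>G\<^esub>\<rparr> = image_group j G"
    by (simp add: image_group_def)
  then show "comm_group (image_group j G)"
    using G.iso_imp_img_comm_group[OF iso] by simp
qed

lemma pure_injective_for_iso:
  assumes F: "comm_group F" and F': "comm_group F'" and iso: "F \<cong> F'"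
    and K: "\<And>B. B \<in> K \<Longrightarrow> group B" and inj: "pure_injective_for F K"
  shows "pure_injective_for F' K"
  unfolding pure_injective_for_def
proof (intro ballI allI impI)
  fix B C f assume B: "B \<in> K" and C: "C \<in> K" and BC: "pure_subgroup B C" and f: "pure_embedding f B F'"
  have grp: "group F" "group F'"
    using F F' by (auto simp: comm_group_def)
  obtain \<iota> where \<iota>: "\<iota> \<in> iso F F'"
    using iso unfolding is_iso_def by blast
  define \<iota>' where "\<iota>' = inv_into (carrier F) \<iota>"
  have \<iota>': "\<iota>' \<in> iso F' F"
    unfolding \<iota>'_def using grp \<iota> by (simp add: group.iso_set_sym)
  have "pure_embedding (\<iota>' \<circ> f) B F"
    using pure_embedding_compose[OF K[OF B] grp(2,1) f iso_imp_pure_embedding[OF grp(2,1) \<iota>']] .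
  then obtain g where g: "pure_embedding g C F" "\<And>x. x \<in> carrier B \<Longrightarrow> g x = (\<iota>' \<circ> f) x"
    using inj B C BC unfolding pure_injective_for_def by blast
  have "pure_embedding (\<iota> \<circ> g) C F'"
    using pure_embedding_compose[OF K[OF C] grp g(1) iso_imp_pure_embedding[OF grp \<iota>]] .
  moreover have "(\<iota> \<circ> g) x = f x" if "x \<in> carrier B" for x
  proof -
    have "f x \<in> \<iota> ` carrier F"
      using hom_in_carrier[OF pure_embedding_hom[OF f] that] \<iota> by (simp add: iso_def bij_betw_def)
    then show ?thesis
      using g(2)[OF that] by (simp add: \<iota>'_def f_inv_into_f)
  qed
  ultimately show "\<exists>g. pure_embedding g C F' \<and> (\<forall>x\<in>carrier B. g x = f x)"
    by blast
qed

section \<open>Partial isomorphisms between pure subgroups\<close>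

lemma subgroup_converse:
  assumes "group G" "group H" "subgroup R (G \<times>\<times> H)"
  shows "subgroup (R\<inverse>) (H \<times>\<times> G)"
proof -
  interpret HG: group "H \<times>\<times> G"
    using assms by (simp add: DirProd_group)
  have carr: "x \<in> carrier G" "y \<in> carrier H" if "(x, y) \<in> R" for x y
    using that subgroup.subset[OF assms(3)] by auto
  show ?thesis
  proof (rule HG.subgroupI)
    show "R\<inverse> \<subseteq> carrier (H \<times>\<times> G)" "R\<inverse> \<noteq> {}"
      using carr subgroup.one_closed[OF assms(3)] by auto
  next
    fix a assume a: "a \<in> R\<inverse>"
    obtain x y where xy: "a = (y, x)" by (cases a)
    then have "(inv\<^bsub>G\<^esub> x, inv\<^bsub>H\<^esub> y) \<in> R"
      using a subgroup.m_inv_closed[OF assms(3)] carr assms(1,2) by fastforce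
    then show "inv\<^bsub>H \<times>\<times> G\<^esub> a \<in> R\<inverse>"
      using a xy carr assms(1,2) by simp
  next
    fix a b assume ab: "a \<in> R\<inverse>" "b \<in> R\<inverse>"
    obtain x y x' y' where xy: "a = (y, x)" "b = (y', x')" by (cases a, cases b)
    then have "(x \<otimes>\<^bsub>G\<^esub> x', y \<otimes>\<^bsub>H\<^esub> y') \<in> R"
      using ab subgroup.m_closed[OF assms(3)] by fastforce
    then show "a \<otimes>\<^bsub>H \<times>\<times> G\<^esub> b \<in> R\<inverse>"
      using xy by simp
  qed
qed

lemma pure_subset_Union_chain:
  assumes B: "group B" and "C \<noteq> {}" and pure: "\<And>S. S \<in> C \<Longrightarrow> pure_subset S B"
    and chain: "\<And>S T. S \<in> C \<Longrightarrow> T \<in> C \<Longrightarrow> S \<subseteq> T \<or> T \<subseteq> S"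
  shows "pure_subset (\<Union>C) B"
proof -
  interpret B: group B by fact
  have sub: "subgroup S B" if "S \<in> C" for S
    using pure[OF that] by (rule pure_subset_subgroup)
  have "subgroup (\<Union>C) B"
  proof (rule B.subgroupI)
    show "\<Union>C \<subseteq> carrier B" "\<Union>C \<noteq> {}"
      using subgroup.subset[OF sub] subgroup.one_closed[OF sub] \<open>C \<noteq> {}\<close> by blast+
    show "inv\<^bsub>B\<^esub> a \<in> \<Union>C" if "a \<in> \<Union>C" for a
      using that subgroup.m_inv_closed[OF sub] by blast
  next
    fix a b assume "a \<in> \<Union>C" "b \<in> \<Union>C"
    then obtain S T where ST: "S \<in> C" "a \<in> S" "T \<in> C" "b \<in> T"
      by blast
    then have "S \<subseteq> T \<or> T \<subseteq> S"
      using chain by blast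
    then show "a \<otimes>\<^bsub>B\<^esub> b \<in> \<Union>C"
      using ST subgroup.m_closed[OF sub[OF ST(1)], of a b] subgroup.m_closed[OF sub[OF ST(3)], of a b]
      by blast
  qed
  moreover have "\<exists>a'\<in>\<Union>C. a = a' [^]\<^bsub>B\<^esub> k"
    if a: "a \<in> \<Union>C" "k \<ge> 1" "\<exists>b\<in>carrier B. a = b [^]\<^bsub>B\<^esub> k" for a and k :: nat
  proof -
    obtain S where S: "S \<in> C" "a \<in> S" using a(1) by blast
    then have "\<exists>a'\<in>S. a = a' [^]\<^bsub>B\<^esub> k"
      using pure[OF S(1)] a unfolding pure_subset_def by blast
    then show ?thesis using S(1) by blast
  qed
  ultimately show ?thesis
    unfolding pure_subset_def by blast
qed

text \<open>With relations, extension is inclusion, limits are unions, and the back step is the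
  forth step for the converse. The second graph condition expresses injectivity.\<close>

definition partial_iso :: "'a monoid \<Rightarrow> 'b monoid \<Rightarrow> ('a \<times> 'b) set \<Rightarrow> bool" where
  "partial_iso F F' R \<longleftrightarrow> hom_graph F F' R \<and> hom_graph F' F (R\<inverse>) \<and>
     pure_subset (Domain R) F \<and> pure_subset (Range R) F'"

lemma partial_iso_converse: "partial_iso F F' R \<Longrightarrow> partial_iso F' F (R\<inverse>)"
  unfolding partial_iso_def by simp

lemma partial_iso_Union_chain:
  assumes F: "group F" and F': "group F'" and "C \<noteq> {}" and iso: "\<And>R. R \<in> C \<Longrightarrow> partial_iso F F' R"
    and chain: "\<And>R S. R \<in> C \<Longrightarrow> S \<in> C \<Longrightarrow> R \<subseteq> S \<or> S \<subseteq> R"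
  shows "partial_iso F F' (\<Union>C)"
proof -
  have "subset.chain {R. hom_graph F F' R} C"
    using iso chain unfolding subset_chain_def partial_iso_def by blast
  then have "hom_graph F F' (\<Union>C)"
    using hom_graph_Union_chain[OF F F' \<open>C \<noteq> {}\<close>] by blast
  have "subset.chain {R. hom_graph F' F R} (converse ` C)"
    using iso chain unfolding subset_chain_def partial_iso_def by (auto simp: converse_mono)
  from hom_graph_Union_chain[OF F' F _ this] have "hom_graph F' F (\<Union>(converse ` C))"
    using \<open>C \<noteq> {}\<close> by simp
  moreover have "(\<Union>C)\<inverse> = \<Union>(converse ` C)" by auto
  ultimately have "hom_graph F' F ((\<Union>C)\<inverse>)" by simp
  have "pure_subset (\<Union>(Domain ` C)) F"
  proof (rule pure_subset_Union_chain[OF F])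
    show "S \<subseteq> T \<or> T \<subseteq> S" if "S \<in> Domain ` C" "T \<in> Domain ` C" for S T
      using that chain Domain_mono by blast
  qed (use iso \<open>C \<noteq> {}\<close> in \<open>auto simp: partial_iso_def\<close>)
  then have "pure_subset (Domain (\<Union>C)) F"
    by (simp add: Domain_Union)
  have "pure_subset (\<Union>(Range ` C)) F'"
  proof (rule pure_subset_Union_chain[OF F'])
    show "S \<subseteq> T \<or> T \<subseteq> S" if "S \<in> Range ` C" "T \<in> Range ` C" for S T
      using that chain Range_mono by blast
  qed (use iso \<open>C \<noteq> {}\<close> in \<open>auto simp: partial_iso_def\<close>)
  then have "pure_subset (Range (\<Union>C)) F'"
    by (simp add: Range_Union)
  show ?thesis
    unfolding partial_iso_def by (intro conjI) fact+
qed

lemma pure_subset_one: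
  assumes "group F"
  shows "pure_subset {\<one>\<^bsub>F\<^esub>} F"
  using group.triv_subgroup[OF assms] group.is_monoid[OF assms]
  unfolding pure_subset_def by (auto simp: monoid.nat_pow_one)

lemma partial_iso_one:
  assumes "group F" "group F'"
  shows "partial_iso F F' {(\<one>\<^bsub>F\<^esub>, \<one>\<^bsub>F'\<^esub>)}"
proof -
  have "subgroup {(\<one>\<^bsub>F\<^esub>, \<one>\<^bsub>F'\<^esub>)} (F \<times>\<times> F')" "subgroup {(\<one>\<^bsub>F'\<^esub>, \<one>\<^bsub>F\<^esub>)} (F' \<times>\<times> F)"
    using group.triv_subgroup[OF DirProd_group[OF assms]] group.triv_subgroup[OF DirProd_group[OF assms(2,1)]]
    by simp_all
  moreover have "{(\<one>\<^bsub>F\<^esub>, \<one>\<^bsub>F'\<^esub>)}\<inverse> = {(\<one>\<^bsub>F'\<^esub>, \<one>\<^bsub>F\<^esub>)}" by auto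
  ultimately show ?thesis
    using pure_subset_one[OF assms(1)] pure_subset_one[OF assms(2)]
    unfolding partial_iso_def hom_graph_def by simp
qed

lemma partial_iso_pure_embedding:
  assumes F: "group F" and F': "group F'" and T: "pure_subset T F"
    and g: "pure_embedding g (F\<lparr>carrier := T\<rparr>) F'"
  shows "partial_iso F F' ((\<lambda>x. (x, g x)) ` T)"
proof -
  have sub: "subgroup T F"
    using T by (rule pure_subset_subgroup)
  have TG: "group (F\<lparr>carrier := T\<rparr>)"
    using F sub by (simp add: group.subgroup_imp_group)
  interpret F: group F by fact
  interpret g: group_hom "F\<lparr>carrier := T\<rparr>" F' g
    using TG F' pure_embedding_hom[OF g] by (simp add: group_hom_def group_hom_axioms_def)
  have inj: "inj_on g T"
    using pure_embedding_inj_on[OF g] by simp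
  interpret P: group "F \<times>\<times> F'"
    using F F' by (simp add: DirProd_group)
  have carr: "x \<in> carrier F" "g x \<in> carrier F'" if "x \<in> T" for x
    using that subgroup.subset[OF sub] g.hom_closed[of x] by auto
  have R: "subgroup ((\<lambda>x. (x, g x)) ` T) (F \<times>\<times> F')"
  proof (rule P.subgroupI)
    show "(\<lambda>x. (x, g x)) ` T \<subseteq> carrier (F \<times>\<times> F')" "(\<lambda>x. (x, g x)) ` T \<noteq> {}"
      using carr subgroup.one_closed[OF sub] by auto
  next
    fix a assume "a \<in> (\<lambda>x. (x, g x)) ` T"
    then obtain x where x: "x \<in> T" "a = (x, g x)" by blast
    then have "inv\<^bsub>F \<times>\<times> F'\<^esub> a = (inv\<^bsub>F\<^esub> x, g (inv\<^bsub>F\<^esub> x))"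
      using carr[OF x(1)] F F' g.hom_inv[of x] F.m_inv_consistent[OF sub x(1)] by simp
    then show "inv\<^bsub>F \<times>\<times> F'\<^esub> a \<in> (\<lambda>x. (x, g x)) ` T"
      using subgroup.m_inv_closed[OF sub x(1)] by auto
  next
    fix a b assume "a \<in> (\<lambda>x. (x, g x)) ` T" "b \<in> (\<lambda>x. (x, g x)) ` T"
    then obtain x y where x: "x \<in> T" "a = (x, g x)" "y \<in> T" "b = (y, g y)" by blast
    then have "a \<otimes>\<^bsub>F \<times>\<times> F'\<^esub> b = (x \<otimes>\<^bsub>F\<^esub> y, g (x \<otimes>\<^bsub>F\<^esub> y))"
      using g.hom_mult[of x y] by simp
    then show "a \<otimes>\<^bsub>F \<times>\<times> F'\<^esub> b \<in> (\<lambda>x. (x, g x)) ` T"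
      using subgroup.m_closed[OF sub x(1,3)] by auto
  qed
  have g1: "g \<one>\<^bsub>F\<^esub> = \<one>\<^bsub>F'\<^esub>"
    using g.hom_one by simp
  have "Domain ((\<lambda>x. (x, g x)) ` T) = T" "Range ((\<lambda>x. (x, g x)) ` T) = g ` T"
    by auto
  moreover have "pure_subset (g ` T) F'"
    using pure_embedding_image[OF g] by simp
  moreover have "x = \<one>\<^bsub>F\<^esub>" if "x \<in> T" "g x = \<one>\<^bsub>F'\<^esub>" for x
    using inj_onD[OF inj, of x "\<one>\<^bsub>F\<^esub>"] that g1 subgroup.one_closed[OF sub] by simp
  ultimately show ?thesis
    using T R subgroup_converse[OF F F' R] g1 unfolding partial_iso_def hom_graph_def by auto
qed

section \<open>Small pure subgroups and the back-and-forth\<close>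

context inaccessible
begin

text \<open>Countably many rounds of adding quotients and chosen roots suffice, as each closure
  condition involves finitely many elements. Every round keeps the set small, and a countable union
  of small sets is small because \<kappa> is uncountable and regular.\<close>

lemma pure_closure:
  assumes F: "group F" and X: "X \<subseteq> carrier F" "small X"
  obtains T where "pure_subset T F" "X \<subseteq> T" "small T"
proof -
  interpret F: group F by fact
  define root where "root k x = (SOME b. b \<in> carrier F \<and> x = b [^]\<^bsub>F\<^esub> k)" for k :: nat and x
  have root: "root k x \<in> carrier F \<and> x = root k x [^]\<^bsub>F\<^esub> k" if "\<exists>b\<in>carrier F. x = b [^]\<^bsub>F\<^esub> k" for k x
    unfolding root_def by (rule someI_ex) (use that in blast)
  \<comment> \<open>Closure under \<open>inv x * y\<close>, together with the unit, yields a
    subgroup. The intersection with the carrier discards the arbitrary values of \<open>root\<close>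
    at elements that have no k-th root.\<close>
  define step where "step S = insert \<one>\<^bsub>F\<^esub> S \<union> (\<lambda>(x, y). inv\<^bsub>F\<^esub> x \<otimes>\<^bsub>F\<^esub> y) ` (S \<times> S) \<union>
      (\<lambda>(k, x). root k x) ` (UNIV \<times> S) \<inter> carrier F" for S
  define S where "S n = (step ^^ n) X" for n
  have S_Suc: "S (Suc n) = step (S n)" for n
    by (simp add: S_def)
  have S_carr: "S n \<subseteq> carrier F" for n
    by (induction n) (use X in \<open>auto simp: S_def step_def\<close>)
  have S_small: "small (S n)" for n
  proof (induction n)
    case 0
    then show ?case using X by (simp add: S_def)
  next
    case (Suc n)
    have "small (insert \<one>\<^bsub>F\<^esub> (S n))"
      using small_Un[OF small_countable[of "{\<one>\<^bsub>F\<^esub>}"] Suc] by simp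
    moreover have "small ((\<lambda>(x, y). inv\<^bsub>F\<^esub> x \<otimes>\<^bsub>F\<^esub> y) ` (S n \<times> S n))"
      by (intro small_image small_Times Suc)
    moreover have "small ((\<lambda>(k, x). root k x) ` (UNIV \<times> S n) \<inter> carrier F)"
      by (rule small_subset[OF small_image[OF small_Times[OF small_countable[of UNIV] Suc]]]) auto
    ultimately show ?case
      unfolding S_Suc step_def by (intro small_Un)
  qed
  have S_mono: "S n \<subseteq> S m" if "n \<le> m" for n m
    using that by (rule lift_Suc_mono_le[rotated]) (auto simp: S_Suc step_def)
  define T where "T = (\<Union>n. S n)"
  have quot: "inv\<^bsub>F\<^esub> x \<otimes>\<^bsub>F\<^esub> y \<in> T" if xy: "x \<in> T" "y \<in> T" for x y
  proof -
    obtain n m where "x \<in> S n" "y \<in> S m"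
      using xy unfolding T_def by blast
    then have "x \<in> S (max n m)" "y \<in> S (max n m)"
      using S_mono[of n "max n m"] S_mono[of m "max n m"] by auto
    then have "inv\<^bsub>F\<^esub> x \<otimes>\<^bsub>F\<^esub> y \<in> S (Suc (max n m))"
      unfolding S_Suc step_def by auto
    then show ?thesis unfolding T_def by blast
  qed
  have T_carr: "x \<in> carrier F" if "x \<in> T" for x
    using that S_carr unfolding T_def by blast
  have "\<one>\<^bsub>F\<^esub> \<in> S (Suc 0)"
    unfolding S_Suc step_def by blast
  then have one: "\<one>\<^bsub>F\<^esub> \<in> T"
    unfolding T_def by blast
  have inv: "inv\<^bsub>F\<^esub> x \<in> T" if "x \<in> T" for x
    using quot[OF that one] T_carr[OF that] by simp
  have "subgroup T F"
  proof (rule F.subgroupI)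
    show "T \<subseteq> carrier F" "T \<noteq> {}"
      using T_carr one by auto
    show "x \<otimes>\<^bsub>F\<^esub> y \<in> T" if "x \<in> T" "y \<in> T" for x y
      using quot[OF inv[OF that(1)] that(2)] T_carr[OF that(1)] by simp
  qed (rule inv)
  moreover have "\<exists>a'\<in>T. a = a' [^]\<^bsub>F\<^esub> k"
    if a: "a \<in> T" "\<exists>b\<in>carrier F. a = b [^]\<^bsub>F\<^esub> k" for a and k :: nat
  proof -
    obtain n where "a \<in> S n"
      using a(1) unfolding T_def by blast
    then have "root k a \<in> S (Suc n)"
      using root[OF a(2)] unfolding S_Suc step_def by auto
    then show ?thesis
      using root[OF a(2)] unfolding T_def by blast
  qed
  ultimately have "pure_subset T F"
    unfolding pure_subset_def by blast
  moreover have "X \<subseteq> T"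
    unfolding T_def using S_def[of 0] by auto
  moreover have "small T"
    unfolding T_def by (rule small_UN[OF small_countable S_small]) simp
  ultimately show ?thesis using that by blast
qed

lemma small_groupsD:
  assumes "G \<in> small_groups \<kappa>"
  shows "comm_group G" "group G" "small (carrier G)"
  using assms unfolding small_groups_def by (auto simp: comm_group_def)

lemma small_inj_into:
  assumes "\<kappa> \<le>o |UNIV :: 'a set|" "small S"
  obtains j :: "'x \<Rightarrow> 'a" where "inj_on j S"
proof -
  have "|S| \<le>o |UNIV :: 'a set|"
    using ordLess_ordLeq_trans[OF assms(2,1)] by (rule ordLess_imp_ordLeq)
  then show ?thesis
    using that iffD2[OF card_of_ordLeq] by blast
qed

text \<open>As \<open>'a\<close> has at least \<kappa> elements, every small group on
  \<open>'x\<close> has a copy there, and an extension problem can be moved to the copy and its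
  solution moved back.\<close>

lemma pure_injective_for_transfer:
  assumes le: "\<kappa> \<le>o |UNIV :: 'a set|" and F: "comm_group F"
    and inj: "pure_injective_for F (small_groups \<kappa> :: 'a monoid set)"
  shows "pure_injective_for F (small_groups \<kappa> :: 'x monoid set)"
  unfolding pure_injective_for_def
proof (intro ballI allI impI)
  fix B C :: "'x monoid" and f
  assume B: "B \<in> small_groups \<kappa>" and C: "C \<in> small_groups \<kappa>"
    and BC: "pure_subgroup B C" and f: "pure_embedding f B F"
  note B' = small_groupsD[OF B] and C' = small_groupsD[OF C]
  have F': "group F"
    using F by (simp add: comm_group_def)
  obtain j :: "'x \<Rightarrow> 'a" where j: "inj_on j (carrier C)"
    using small_inj_into[OF le C'(3)] by blast
  define C1 where "C1 = image_group j C"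
  \<comment> \<open>Taking the copy of B as a substructure of the copy of C keeps the inclusion
    literal, as pure-injectivity demands.\<close>
  define B1 where "B1 = C1\<lparr>carrier := j ` carrier B\<rparr>"
  have C1: "comm_group C1" "j \<in> iso C C1"
    unfolding C1_def using comm_group_image_group[OF C'(1) j] by auto
  then have C1g: "group C1"
    by (simp add: comm_group_def)
  have "pure_embedding (j \<circ> (\<lambda>x. x)) B C1"
    using pure_embedding_compose[OF B'(2) C'(2) C1g pure_subgroup_imp_pure_embedding[OF BC]]
      iso_imp_pure_embedding[OF C'(2) C1g C1(2)] by blast
  then have jB: "pure_embedding j B C1"
    by (simp add: o_def)
  then have B1C1: "pure_subgroup B1 C1"
    unfolding B1_def by (rule pure_subgroup_restrict[OF pure_embedding_image])
  have B1: "comm_group B1"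
    using comm_group_pure_subgroup[OF C1(1) B1C1] .
  then have B1g: "group B1"
    by (simp add: comm_group_def)
  have C1c: "carrier C1 = j ` carrier C"
    by (simp add: C1_def image_group_carrier)
  have K: "B1 \<in> small_groups \<kappa>" "C1 \<in> small_groups \<kappa>"
    using B1 C1(1) small_image B'(3) C'(3) by (auto simp: small_groups_def B1_def C1c)
  have jiso: "j \<in> iso B B1"
    using pure_embedding_hom[OF jB] pure_embedding_inj_on[OF jB]
    by (auto simp: iso_def hom_def bij_betw_def B1_def)
  define j' where "j' = inv_into (carrier B) j"
  have j': "j' \<in> iso B1 B"
    unfolding j'_def using B'(2) jiso by (rule group.iso_set_sym)
  have "pure_embedding (f \<circ> j') B1 F"
    using pure_embedding_compose[OF B1g B'(2) F' iso_imp_pure_embedding[OF B1g B'(2) j'] f] .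
  then obtain g where g: "pure_embedding g C1 F" "\<And>x. x \<in> carrier B1 \<Longrightarrow> g x = (f \<circ> j') x"
    using inj K B1C1 unfolding pure_injective_for_def by blast
  have "pure_embedding (g \<circ> j) C F"
    using pure_embedding_compose[OF C'(2) C1g F' iso_imp_pure_embedding[OF C'(2) C1g C1(2)] g(1)] .
  moreover have "(g \<circ> j) x = f x" if "x \<in> carrier B" for x
    using g(2)[of "j x"] that pure_embedding_inj_on[OF jB] by (simp add: j'_def B1_def)
  ultimately show "\<exists>g. pure_embedding g C F \<and> (\<forall>x\<in>carrier B. g x = f x)"
    by blast
qed

text \<open>The forth step. Pure-injectivity of F' speaks of small groups, so x is adjoined inside a
  small pure subgroup T obtained from \<open>pure_closure\<close>. Both groups of the extension
  problem are subgroups of F, whence the type of the class.\<close>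

lemma partial_iso_extend:
  fixes F :: "'x monoid" and F' :: "'y monoid"
  assumes F: "comm_group F" and F': "comm_group F'"
    and inj: "pure_injective_for F' (small_groups \<kappa> :: 'x monoid set)"
    and R: "partial_iso F F' R" "small R" and x: "x \<in> carrier F"
  obtains R' where "partial_iso F F' R'" "small R'" "R \<subseteq> R'" "x \<in> Domain R'"
proof -
  have grp: "group F" "group F'"
    using F F' by (auto simp: comm_group_def)
  have graph: "hom_graph F F' R" "hom_graph F' F (R\<inverse>)"
    and pure: "pure_subset (Domain R) F" "pure_subset (Range R) F'"
    using R(1) unfolding partial_iso_def by auto
  have "Domain R = fst ` R" by force
  then have "small (Domain R)"
    using small_image[OF R(2)] by simp
  then have "small (insert x (Domain R))"
    using small_Un[OF small_countable[of "{x}"]] by simp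
  moreover have "insert x (Domain R) \<subseteq> carrier F"
    using x subgroup.subset[OF pure_subset_subgroup[OF pure(1)]] by blast
  ultimately obtain T where T: "pure_subset T F" "insert x (Domain R) \<subseteq> T" "small T"
    using pure_closure[OF grp(1)] by blast
  have Tsub: "subgroup T F"
    using T(1) by (rule pure_subset_subgroup)
  define B C where "B = F\<lparr>carrier := Domain R\<rparr>" and "C = F\<lparr>carrier := T\<rparr>"
  have K: "B \<in> small_groups \<kappa>" "C \<in> small_groups \<kappa>"
    using comm_group_subgroup[OF F pure_subset_subgroup[OF pure(1)]] comm_group_subgroup[OF F Tsub]
      \<open>small (Domain R)\<close> T(3) by (auto simp: B_def C_def small_groups_def)
  have "pure_subset (Domain R) C"
    unfolding C_def using pure_subset_restrict[OF grp(1) pure(1) Tsub] T(2) by blast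
  then have BC: "pure_subgroup B C"
    by (simp add: pure_subgroup_def B_def C_def)
  obtain f where f: "f \<in> hom B F'" "\<And>x y. (x, y) \<in> R \<Longrightarrow> f x = y"
    unfolding B_def using hom_graph_hom[OF grp graph(1)] by blast
  have "inj_on f (Domain R)"
  proof (rule inj_onI)
    fix a b assume "a \<in> Domain R" "b \<in> Domain R" "f a = f b"
    then have "(f a, a) \<in> R\<inverse>" "(f a, b) \<in> R\<inverse>"
      using f(2) by (metis DomainE converse_iff)+
    then show "a = b"
      using hom_graph_unique[OF grp(2,1) graph(2)] by blast
  qed
  moreover have "f ` Domain R = Range R"
    using f(2) by (force simp: image_iff)
  ultimately have "pure_embedding f B F'"
    using f(1) pure(2) unfolding pure_embedding_def by (simp add: B_def)
  then obtain g where g: "pure_embedding g C F'" "\<And>x. x \<in> carrier B \<Longrightarrow> g x = f x"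
    using inj K BC unfolding pure_injective_for_def by blast
  show ?thesis
  proof (rule that)
    show "partial_iso F F' ((\<lambda>x. (x, g x)) ` T)"
      using partial_iso_pure_embedding[OF grp T(1)] g(1) unfolding C_def by blast
    show "small ((\<lambda>x. (x, g x)) ` T)"
      using small_image[OF T(3)] .
    show "R \<subseteq> (\<lambda>x. (x, g x)) ` T"
    proof
      fix a assume "a \<in> R"
      then obtain u v where a: "a = (u, v)" "(u, v) \<in> R" by (cases a) auto
      then have "u \<in> Domain R" by blast
      then have "v = g u" "u \<in> T"
        using f(2)[OF a(2)] g(2)[of u] T(2) by (auto simp: B_def)
      then show "a \<in> (\<lambda>x. (x, g x)) ` T"
        using a by blast
    qed
    show "x \<in> Domain ((\<lambda>x. (x, g x)) ` T)"
      using T(2) by blast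
  qed
qed

text \<open>The back step is the forth step for the converse relation with the two groups
  exchanged.\<close>

lemma partial_iso_extend_both:
  fixes F :: "'x monoid" and F' :: "'y monoid"
  assumes F: "comm_group F" and F': "comm_group F'"
    and inj: "pure_injective_for F (small_groups \<kappa> :: 'y monoid set)"
      "pure_injective_for F' (small_groups \<kappa> :: 'x monoid set)"
    and R: "partial_iso F F' R" "small R" and x: "x \<in> carrier F" and y: "y \<in> carrier F'"
  obtains R' where "partial_iso F F' R'" "small R'" "R \<subseteq> R'" "x \<in> Domain R'" "y \<in> Range R'"
proof -
  obtain S where S: "partial_iso F F' S" "small S" "R \<subseteq> S" "x \<in> Domain S"
    by (rule partial_iso_extend[OF F F' inj(2) R x])
  have conv: "R\<inverse> = prod.swap ` R" for R :: "('u \<times> 'v) set" by auto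
  have "small (S\<inverse>)"
    unfolding conv using S(2) by (rule small_image)
  then obtain R' where R': "partial_iso F' F R'" "small R'" "S\<inverse> \<subseteq> R'" "y \<in> Domain R'"
    by (rule partial_iso_extend[OF F' F inj(1) partial_iso_converse[OF S(1)] _ y])
  show ?thesis
  proof (rule that)
    show "partial_iso F F' (R'\<inverse>)"
      using R'(1) by (rule partial_iso_converse)
    show "small (R'\<inverse>)"
      unfolding conv using R'(2) by (rule small_image)
    show "R \<subseteq> R'\<inverse>" "x \<in> Domain (R'\<inverse>)" "y \<in> Range (R'\<inverse>)"
      using S(3,4) R'(3,4) by auto
  qed
qed

lemma card_eq_kappa_enum:
  assumes "|S| =o \<kappa>"
  obtains e where "e ` Field \<kappa> = S"
proof -
  have "|Field \<kappa>| =o |S|"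
    using ordIso_transitive[OF card_of_Field_ordIso[OF card_order] ordIso_symmetric[OF assms]] .
  then show ?thesis
    using that iffD2[OF card_of_ordIso] by (metis bij_betw_imp_surj_on)
qed

text \<open>Stage a takes care of the a-th element of either enumeration, and regularity keeps the
  union of the earlier stages small, so that every stage can be extended. The class for each group
  lives on the type of the other because its test groups are subgroups of that other group.\<close>

lemma pure_injective_unique:
  fixes F :: "'x monoid" and F' :: "'y monoid"
  assumes F: "comm_group F" and F': "comm_group F'"
    and card: "|carrier F| =o \<kappa>" "|carrier F'| =o \<kappa>"
    and inj: "pure_injective_for F (small_groups \<kappa> :: 'y monoid set)"
      "pure_injective_for F' (small_groups \<kappa> :: 'x monoid set)"
  shows "F \<cong> F'"
proof -
  interpret wo: wo_rel \<kappa> by (rule wo_rel)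
  have grp: "group F" "group F'"
    using F F' by (auto simp: comm_group_def)
  obtain e where e: "e ` Field \<kappa> = carrier F"
    by (rule card_eq_kappa_enum[OF card(1)])
  obtain e' where e': "e' ` Field \<kappa> = carrier F'"
    by (rule card_eq_kappa_enum[OF card(2)])
  define good where "good a R R' \<longleftrightarrow> partial_iso F F' R' \<and> small R' \<and> R \<subseteq> R' \<and> e a \<in> Domain R' \<and> e' a \<in> Range R'"
    for a R R'
  \<comment> \<open>The pair of units makes the first stage start from the trivial partial
    isomorphism instead of the empty relation, which is not a subgroup.\<close>
  define base where "base f a = insert (\<one>\<^bsub>F\<^esub>, \<one>\<^bsub>F'\<^esub>) (\<Union>(f ` wo.underS a))" for f :: "'k \<Rightarrow> ('x \<times> 'y) set" and a
  define H where "H f a = (SOME R'. good a (base f a) R')" for f a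
  define p where "p = wo.worec H"
  have "wo.adm_wo H"
    unfolding wo.adm_wo_def H_def base_def by (auto cong: image_cong)
  then have p_eq: "p = H p"
    unfolding p_def using wo.worec_fixpoint by blast
  have step: "a \<in> Field \<kappa> \<longrightarrow> good a (base p a) (p a)" for a
  proof (induction a rule: wo.well_order_induct, intro impI)
    fix a assume IH: "\<forall>b. b \<noteq> a \<and> (b, a) \<in> \<kappa> \<longrightarrow> b \<in> Field \<kappa> \<longrightarrow> good b (base p b) (p b)"
      and a: "a \<in> Field \<kappa>"
    have IH': "good b (base p b) (p b)" if "b \<in> wo.underS a" for b
      using IH that unfolding underS_def Field_def by blast
    have mono: "p b \<subseteq> p c" if "b \<in> wo.underS c" "c \<in> wo.underS a" for b c
      using IH'[OF that(2)] that(1) unfolding good_def base_def by blast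
    have base: "partial_iso F F' (base p a)"
    proof (cases "wo.underS a = {}")
      case True
      then show ?thesis
        using partial_iso_one[OF grp] by (simp add: base_def)
    next
      \<comment> \<open>Here the pair of units already lies in an earlier stage, so
        \<open>base\<close> is the plain union of a chain.\<close>
      case False
      have "(\<one>\<^bsub>F\<^esub>, \<one>\<^bsub>F'\<^esub>) \<in> \<Union>(p ` wo.underS a)"
        using IH' False unfolding good_def base_def by blast
      then have "base p a = \<Union>(p ` wo.underS a)"
        unfolding base_def by blast
      moreover have "partial_iso F F' (\<Union>(p ` wo.underS a))"
      proof (rule partial_iso_Union_chain[OF grp])
        show "R \<subseteq> S \<or> S \<subseteq> R" if RS: "R \<in> p ` wo.underS a" "S \<in> p ` wo.underS a" for R S
        proof -
          obtain b c where bc: "b \<in> wo.underS a" "R = p b" "c \<in> wo.underS a" "S = p c"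
            using RS by blast
          then have "b = c \<or> b \<in> wo.underS c \<or> c \<in> wo.underS b"
            using wo.TOTALS unfolding underS_def Field_def by blast
          then show ?thesis using mono bc by blast
        qed
      qed (use False IH' in \<open>auto simp: good_def\<close>)
      ultimately show ?thesis by simp
    qed
    have "small (\<Union>(p ` wo.underS a))"
      using small_UN[OF small_underS[OF a], of p] IH' unfolding good_def by blast
    then have "small (base p a)"
      unfolding base_def using small_Un[OF small_countable[of "{(\<one>\<^bsub>F\<^esub>, \<one>\<^bsub>F'\<^esub>)}"]] by simp
    moreover have "e a \<in> carrier F" "e' a \<in> carrier F'"
      using a e e' by auto
    ultimately have "\<exists>R'. good a (base p a) R'"
      using partial_iso_extend_both[OF F F' inj base] unfolding good_def by metis
    from someI_ex[OF this] have "good a (base p a) (H p a)"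
      unfolding H_def .
    then show "good a (base p a) (p a)"
      using p_eq by simp
  qed
  then have good: "good a (base p a) (p a)" if "a \<in> Field \<kappa>" for a
    using that by blast
  define R where "R = \<Union>(p ` Field \<kappa>)"
  have "partial_iso F F' R"
    unfolding R_def
  proof (rule partial_iso_Union_chain[OF grp])
    show "p ` Field \<kappa> \<noteq> {}"
      using infinite_Field by auto
    show "S \<subseteq> T \<or> T \<subseteq> S" if ST: "S \<in> p ` Field \<kappa>" "T \<in> p ` Field \<kappa>" for S T
    proof -
      obtain b c where bc: "b \<in> Field \<kappa>" "S = p b" "c \<in> Field \<kappa>" "T = p c"
        using ST by blast
      then have "b = c \<or> b \<in> wo.underS c \<or> c \<in> wo.underS b"
        using wo.TOTALS unfolding underS_def by blast
      then show ?thesis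
        using good[OF bc(1)] good[OF bc(3)] bc unfolding good_def base_def by blast
    qed
  qed (use good in \<open>auto simp: good_def\<close>)
  then have graph: "hom_graph F F' R" "hom_graph F' F (R\<inverse>)"
    unfolding partial_iso_def by auto
  have carr: "R \<subseteq> carrier F \<times> carrier F'"
    using graph(1) subgroup.subset unfolding hom_graph_def by fastforce
  have "carrier F \<subseteq> Domain R" "carrier F' \<subseteq> Range R"
    using good unfolding good_def R_def e[symmetric] e'[symmetric] by blast+
  then have dom: "Domain R = carrier F" and ran: "Range R = carrier F'"
    using carr by blast+
  obtain g where g: "g \<in> hom (F\<lparr>carrier := Domain R\<rparr>) F'" "\<And>x y. (x, y) \<in> R \<Longrightarrow> g x = y"
    using hom_graph_hom[OF grp graph(1)] by blast
  have gR: "(x, g x) \<in> R" if "x \<in> carrier F" for x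
    using that g(2) dom by (metis DomainE)
  have "inj_on g (carrier F)"
  proof (rule inj_onI)
    fix a b assume "a \<in> carrier F" "b \<in> carrier F" "g a = g b"
    then have "(g a, a) \<in> R\<inverse>" "(g a, b) \<in> R\<inverse>"
      using gR[of a] gR[of b] by auto
    then show "a = b"
      using hom_graph_unique[OF grp(2,1) graph(2)] by blast
  qed
  moreover have "g ` carrier F = carrier F'"
  proof
    show "g ` carrier F \<subseteq> carrier F'"
      using gR carr by blast
    show "carrier F' \<subseteq> g ` carrier F"
    proof
      fix y assume "y \<in> carrier F'"
      then obtain x where "(x, y) \<in> R"
        using ran by blast
      then show "y \<in> g ` carrier F"
        using g(2)[of x y] carr by blast
    qed
  qed
  moreover have "g \<in> hom F F'"
    using g(1) dom by simp
  ultimately show ?thesis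
    unfolding is_iso_def iso_def bij_betw_def by blast
qed

end


subsection \<open>The supported product\<close>

lemma countable_pruefer: "prime p \<Longrightarrow> countable (carrier (pruefer_group p))"
proof -
  assume "prime p"
  then have "p ^ n \<ge> 1" for n
    using prime_gt_0_nat by (simp add: Suc_le_eq)
  then have fin: "finite {z::complex. z ^ (p ^ n) = 1}" for n
    by (rule finite_roots_unity)
  have "countable (\<Union>n. {z::complex. z ^ (p ^ n) = 1})"
    by (rule countable_UN) (auto intro: countable_finite fin)
  moreover have "carrier (pruefer_group p) = (\<Union>n. {z. z ^ (p ^ n) = 1})"
    by auto
  ultimately show ?thesis by simp
qed

lemma countable_cocyclic:
  assumes "prime p" "cocyclic_of_type p n G"
  shows "countable (carrier G)"
proof -
  obtain \<iota> where "\<iota> \<in> iso G (roots_group p (cocyclic_exponent p n))"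
    by (rule cocyclic_of_type_isoE[OF assms])
  then have "inj_on \<iota> (carrier G)" "\<iota> ` carrier G \<subseteq> carrier (pruefer_group p)"
    by (auto simp: iso_def bij_betw_def)
  then show ?thesis
    using countable_image_inj_on countable_subset countable_pruefer[OF assms(1)] by metis
qed

text \<open>The trivial group, of type p^0, counts as co-cyclic, so the lower bound for the size of
  the product needs a type known to be non-trivial. In the model of Z(2) the witness is -1.\<close>

lemma cocyclic_nontrivial:
  assumes G: "cocyclic_of_type 2 (enat 1) G"
  obtains u where "u \<in> carrier G" "u \<noteq> \<one>\<^bsub>G\<^esub>"
proof -
  obtain \<iota> where \<iota>: "\<iota> \<in> iso G (roots_group 2 (cocyclic_exponent 2 (enat 1)))"
    by (rule cocyclic_of_type_isoE[OF two_is_prime_nat G])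
  have grp: "group G" "group (roots_group 2 (cocyclic_exponent 2 (enat 1)))"
    using G comm_group_roots[OF two_is_prime_nat] unfolding cocyclic_of_type_def by (auto simp: comm_group_def)
  have "\<exists>n. (-1::complex) ^ (2 ^ n) = 1"
    by (rule exI[of _ 1]) simp
  then have "-1 \<in> carrier (roots_group 2 (cocyclic_exponent 2 (enat 1)))"
    by (simp add: cocyclic_exponent_def)
  moreover have "\<iota> ` carrier G = carrier (roots_group 2 (cocyclic_exponent 2 (enat 1)))"
    using \<iota> by (simp add: iso_def bij_betw_def del: roots_group_simps(1))
  ultimately obtain u where u: "u \<in> carrier G" "\<iota> u = -1"
    by (metis imageE)
  have "\<iota> \<one>\<^bsub>G\<^esub> = 1"
    using hom_one[of \<iota>, OF _ grp] \<iota> by (simp add: iso_def del: roots_group_simps(1))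
  then have "u \<noteq> \<one>\<^bsub>G\<^esub>"
    using u(2) by auto
  then show ?thesis
    using that u(1) by blast
qed

locale cocyclic_product = inaccessible \<kappa> for \<kappa> :: "'k rel" +
  fixes H :: "'k \<Rightarrow> 'c monoid"
  assumes family: "cocyclic_family \<kappa> H"
begin

abbreviation P where "P \<equiv> supported_product \<kappa> H"

definition supp :: "('k \<Rightarrow> 'c) \<Rightarrow> 'k set" where
  "supp x = {\<alpha> \<in> Field \<kappa>. x \<alpha> \<noteq> \<one>\<^bsub>H \<alpha>\<^esub>}"

lemma coordinate_type:
  assumes "\<alpha> \<in> Field \<kappa>"
  obtains p n where "prime p" "cocyclic_of_type p n (H \<alpha>)"
  using assms family unfolding cocyclic_family_def cocyclic_def by blast

lemma coordinate_group:
  assumes "\<alpha> \<in> Field \<kappa>"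
  shows "comm_group (H \<alpha>)" "group (H \<alpha>)"
  using coordinate_type[OF assms] unfolding cocyclic_of_type_def by (auto simp: comm_group_def)

lemma not_small_type:
  "prime p \<Longrightarrow> \<not> small {\<alpha> \<in> Field \<kappa>. cocyclic_of_type p n (H \<alpha>)}"
  using family not_small unfolding cocyclic_family_def by metis

lemma P_simps:
  "carrier P = {x \<in> \<Pi>\<^sub>E \<alpha>\<in>Field \<kappa>. carrier (H \<alpha>). small (supp x)}"
  "x \<otimes>\<^bsub>P\<^esub> y = (\<lambda>\<alpha>\<in>Field \<kappa>. x \<alpha> \<otimes>\<^bsub>H \<alpha>\<^esub> y \<alpha>)"
  "\<one>\<^bsub>P\<^esub> = (\<lambda>\<alpha>\<in>Field \<kappa>. \<one>\<^bsub>H \<alpha>\<^esub>)"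
  by (simp_all add: supported_product_def supp_def)

lemma P_coordinate: "x \<in> carrier P \<Longrightarrow> \<alpha> \<in> Field \<kappa> \<Longrightarrow> x \<alpha> \<in> carrier (H \<alpha>)"
  unfolding P_simps by (auto simp: PiE_iff)

lemma P_ext:
  assumes "x \<in> carrier P" "y \<in> carrier P" "\<And>\<alpha>. \<alpha> \<in> Field \<kappa> \<Longrightarrow> x \<alpha> = y \<alpha>"
  shows "x = y"
proof (rule extensionalityI)
  show "x \<in> extensional (Field \<kappa>)" "y \<in> extensional (Field \<kappa>)"
    using assms(1,2) unfolding P_simps by (auto simp: PiE_iff)
qed (rule assms(3))

lemma comm_group_P: "comm_group P"
proof -
  have grp: "group (product_group (Field \<kappa>) H)"
    using coordinate_group by simp
  interpret G: group "product_group (Field \<kappa>) H" by fact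
  have "comm_group (product_group (Field \<kappa>) H)"
    by (rule G.group_comm_groupI)
      (auto simp: PiE_iff intro!: restrict_ext comm_monoid.m_comm comm_group.axioms(1) coordinate_group(1))
  moreover have "subgroup (carrier P) (product_group (Field \<kappa>) H)"
  proof (rule G.subgroupI)
    show "carrier P \<subseteq> carrier (product_group (Field \<kappa>) H)"
      unfolding P_simps by auto
    have "supp \<one>\<^bsub>product_group (Field \<kappa>) H\<^esub> = {}"
      by (simp add: supp_def)
    then have "\<one>\<^bsub>product_group (Field \<kappa>) H\<^esub> \<in> carrier P"
      using G.one_closed small_countable[of "{}"] unfolding P_simps by simp
    then show "carrier P \<noteq> {}" by blast
  next
    fix x assume x: "x \<in> carrier P"
    then have x': "x \<in> carrier (product_group (Field \<kappa>) H)" "small (supp x)"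
      unfolding P_simps by auto
    have "inv\<^bsub>product_group (Field \<kappa>) H\<^esub> x = (\<lambda>\<alpha>\<in>Field \<kappa>. inv\<^bsub>H \<alpha>\<^esub> x \<alpha>)"
      using x' coordinate_group by simp
    then have "supp (inv\<^bsub>product_group (Field \<kappa>) H\<^esub> x) \<subseteq> supp x"
      using coordinate_group(2) by (auto simp: supp_def group.is_monoid monoid.inv_one)
    then show "inv\<^bsub>product_group (Field \<kappa>) H\<^esub> x \<in> carrier P"
      using G.inv_closed[OF x'(1)] small_subset[OF x'(2)] unfolding P_simps by simp
  next
    fix x y assume "x \<in> carrier P" "y \<in> carrier P"
    then have xy: "x \<in> carrier (product_group (Field \<kappa>) H)" "small (supp x)"
        "y \<in> carrier (product_group (Field \<kappa>) H)" "small (supp y)"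
      unfolding P_simps by auto
    have "supp (x \<otimes>\<^bsub>product_group (Field \<kappa>) H\<^esub> y) \<subseteq> supp x \<union> supp y"
      using coordinate_group(2) by (auto simp: supp_def group.is_monoid)
    then show "x \<otimes>\<^bsub>product_group (Field \<kappa>) H\<^esub> y \<in> carrier P"
      using G.m_closed[OF xy(1,3)] small_subset[OF small_Un[OF xy(2,4)]] unfolding P_simps(1) by simp
  qed
  ultimately have "comm_group ((product_group (Field \<kappa>) H)\<lparr>carrier := carrier P\<rparr>)"
    by (rule comm_group_subgroup)
  then show ?thesis
    unfolding supported_product_def by simp
qed

lemma group_P: "group P"
  using comm_group_P by (simp add: comm_group_def)

lemma projection_hom: "\<alpha> \<in> Field \<kappa> \<Longrightarrow> (\<lambda>x. x \<alpha>) \<in> hom P (H \<alpha>)"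
  by (rule homI) (auto simp: P_coordinate P_simps(2))

lemma P_pow: "\<alpha> \<in> Field \<kappa> \<Longrightarrow> x \<in> carrier P \<Longrightarrow> (x [^]\<^bsub>P\<^esub> (k::nat)) \<alpha> = x \<alpha> [^]\<^bsub>H \<alpha>\<^esub> k"
  using hom_nat_pow[OF projection_hom] group_P coordinate_group(2) by blast

text \<open>Upper bound: by regularity every support is bounded, so P is a union of \<kappa> many
  sets \<open>Q a\<close>, and each of these is small by the strong limit property because the
  coordinates are countable. Lower bound: the \<kappa> many coordinates of type Z(2) carry pairwise
  distinct elements supported at a single point.\<close>

lemma card_P: "|carrier P| =o \<kappa>"
proof (rule card_eq_kappa)
  define Q where "Q a = {x \<in> carrier P. supp x \<subseteq> underS \<kappa> a}" for a
  have "carrier P = (\<Union>a\<in>Field \<kappa>. Q a)"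
  proof -
    have "\<exists>a\<in>Field \<kappa>. supp x \<subseteq> underS \<kappa> a" if x: "x \<in> carrier P" for x
    proof -
      have "supp x \<subseteq> Field \<kappa>" "small (supp x)"
        using x unfolding P_simps by (auto simp: supp_def)
      then obtain a where "a \<in> Field \<kappa>" "supp x \<subseteq> underS \<kappa> a"
        by (rule small_bounded)
      then show ?thesis by blast
    qed
    then show ?thesis unfolding Q_def by blast
  qed
  moreover have "small (Q a)" if a: "a \<in> Field \<kappa>" for a
  proof -
    \<comment> \<open>The graph of x below a, with the values numbered inside their countable
      groups. Elements of \<open>Q a\<close> are trivial at the remaining coordinates, so the code
      determines x.\<close>
    define code where "code x = (\<lambda>\<alpha>. (\<alpha>, to_nat_on (carrier (H \<alpha>)) (x \<alpha>))) ` underS \<kappa> a" for x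
    have sub: "\<alpha> \<in> Field \<kappa>" if "\<alpha> \<in> underS \<kappa> a" for \<alpha>
      using that by (auto simp: underS_def Field_def)
    have "inj_on code (Q a)"
    proof (rule inj_onI)
      fix x y assume xy: "x \<in> Q a" "y \<in> Q a" "code x = code y"
      have xy': "x \<in> carrier P" "y \<in> carrier P"
        using xy unfolding Q_def by auto
      show "x = y"
      proof (rule P_ext[OF xy'])
        fix \<alpha> assume \<alpha>: "\<alpha> \<in> Field \<kappa>"
        show "x \<alpha> = y \<alpha>"
        proof (cases "\<alpha> \<in> underS \<kappa> a")
          case True
          then have "(\<alpha>, to_nat_on (carrier (H \<alpha>)) (x \<alpha>)) \<in> code y"
            unfolding xy(3)[symmetric] by (auto simp: code_def)
          then have "to_nat_on (carrier (H \<alpha>)) (x \<alpha>) = to_nat_on (carrier (H \<alpha>)) (y \<alpha>)"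
            unfolding code_def by auto
          moreover have "countable (carrier (H \<alpha>))"
            using coordinate_type[OF \<alpha>] countable_cocyclic by metis
          ultimately show ?thesis
            using P_coordinate[OF _ \<alpha>] xy' inj_on_to_nat_on unfolding inj_on_def by blast
        next
          case False
          then have "x \<alpha> = \<one>\<^bsub>H \<alpha>\<^esub>" "y \<alpha> = \<one>\<^bsub>H \<alpha>\<^esub>"
            using xy(1,2) \<alpha> unfolding Q_def supp_def by blast+
          then show ?thesis by simp
        qed
      qed
    qed
    moreover have "code ` Q a \<subseteq> Pow (underS \<kappa> a \<times> UNIV)"
      unfolding code_def by auto
    moreover have "small (Pow (underS \<kappa> a \<times> (UNIV :: nat set)))"
      by (intro small_Pow small_Times small_underS a small_countable) simp
    ultimately show ?thesis
      by (rule small_inj_on)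
  qed
  then have "|\<Union>a\<in>Field \<kappa>. Q a| \<le>o \<kappa>"
    by (intro card_UN_le ordIso_imp_ordLeq[OF card_of_Field_ordIso[OF card_order]] ordLess_imp_ordLeq)
  ultimately show "|carrier P| \<le>o \<kappa>" by simp
next
  define T where "T = {\<alpha> \<in> Field \<kappa>. cocyclic_of_type 2 (enat 1) (H \<alpha>)}"
  have "\<forall>\<alpha>\<in>T. \<exists>u. u \<in> carrier (H \<alpha>) \<and> u \<noteq> \<one>\<^bsub>H \<alpha>\<^esub>"
    unfolding T_def using cocyclic_nontrivial by blast
  then obtain u where u: "\<And>\<alpha>. \<alpha> \<in> T \<Longrightarrow> u \<alpha> \<in> carrier (H \<alpha>) \<and> u \<alpha> \<noteq> \<one>\<^bsub>H \<alpha>\<^esub>"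
    by metis
  define d where "d \<alpha> = (\<lambda>\<beta>\<in>Field \<kappa>. if \<beta> = \<alpha> then u \<alpha> else \<one>\<^bsub>H \<beta>\<^esub>)" for \<alpha>
  have "d ` T \<subseteq> carrier P"
  proof (rule image_subsetI)
    fix \<alpha> assume \<alpha>: "\<alpha> \<in> T"
    have "supp (d \<alpha>) \<subseteq> {\<alpha>}"
      by (auto simp: supp_def d_def)
    then have "small (supp (d \<alpha>))"
      using small_subset small_countable[of "{\<alpha>}"] by blast
    moreover have "d \<alpha> \<in> (\<Pi>\<^sub>E \<alpha>\<in>Field \<kappa>. carrier (H \<alpha>))"
      using u[OF \<alpha>] coordinate_group(2) by (auto simp: d_def group.is_monoid monoid.one_closed)
    ultimately show "d \<alpha> \<in> carrier P"
      unfolding P_simps by blast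
  qed
  moreover have "inj_on d T"
  proof (rule inj_onI)
    fix \<alpha> \<beta> assume \<alpha>\<beta>: "\<alpha> \<in> T" "\<beta> \<in> T" "d \<alpha> = d \<beta>"
    then have "d \<beta> \<alpha> = u \<alpha>"
      unfolding \<alpha>\<beta>(3)[symmetric] by (simp add: d_def T_def)
    moreover have "d \<beta> \<alpha> = \<one>\<^bsub>H \<alpha>\<^esub>" if "\<alpha> \<noteq> \<beta>"
      using that \<alpha>\<beta>(1) by (simp add: d_def T_def)
    ultimately show "\<alpha> = \<beta>"
      using u[OF \<alpha>\<beta>(1)] by metis
  qed
  moreover have "\<not> small T"
    unfolding T_def by (rule not_small_type) simp
  ultimately show "\<not> small (carrier P)"
    using small_inj_on by metis
qed

text \<open>The order of the choices matters: first a type (p, n) for every pair (c, k) to be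
  separated, then distinct coordinates of these types outside the supports of the values of f, and
  only then a homomorphism for each coordinate.\<close>

lemma pure_injective_P: "pure_injective_for P (small_groups \<kappa> :: 'x monoid set)"
  unfolding pure_injective_for_def
proof (intro ballI allI impI)
  fix B C :: "'x monoid" and f
  assume B: "B \<in> small_groups \<kappa>" and C: "C \<in> small_groups \<kappa>"
    and BC: "pure_subgroup B C" and f: "pure_embedding f B P"
  note B' = small_groupsD[OF B] and C' = small_groupsD[OF C] and BC' = pure_subgroup_eq[OF BC]
  interpret B: comm_group B by (rule B')
  interpret C: comm_group C by (rule C')
  interpret P: comm_group P by (rule comm_group_P)
  have f_hom: "f \<in> hom B P"
    using f by (rule pure_embedding_hom)
  have fP: "f b \<in> carrier P" if "b \<in> carrier B" for b
    using that by (rule hom_in_carrier[OF f_hom])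
  have f\<alpha>: "(\<lambda>b. f b \<alpha>) \<in> hom B (H \<alpha>)" if "\<alpha> \<in> Field \<kappa>" for \<alpha>
    using hom_compose[OF f_hom projection_hom[OF that]] by (simp add: o_def)
  define S where "S = (\<Union>b\<in>carrier B. supp (f b))"
  have S: "small S"
    unfolding S_def using fP unfolding P_simps by (intro small_UN B'(3)) auto
  \<comment> \<open>The pairs with c outside B + kC; for k = 0 this says that c is outside
    B.\<close>
  define J where "J = {(c, k). c \<in> carrier C \<and>
    (\<forall>b\<in>carrier B. \<forall>d\<in>carrier C. c \<noteq> b \<otimes>\<^bsub>C\<^esub> d [^]\<^bsub>C\<^esub> (k::nat))}"
  have J: "small J"
    by (rule small_subset[OF small_Times[OF C'(3) small_countable[of "UNIV :: nat set"]]]) (auto simp: J_def)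
  define separates where "separates i p n \<longleftrightarrow> prime p \<and>
    (\<forall>G :: 'c monoid. cocyclic_of_type p n G \<longrightarrow>
       (\<exists>\<phi>\<in>hom C G. (\<forall>x\<in>carrier B. \<phi> x = \<one>\<^bsub>G\<^esub>) \<and> \<phi> (fst i) \<noteq> \<one>\<^bsub>G\<^esub>) \<and>
       (snd i \<ge> 1 \<longrightarrow> (\<forall>y\<in>carrier G. y [^]\<^bsub>G\<^esub> (snd i) = \<one>\<^bsub>G\<^esub>)))" for i :: "'x \<times> nat" and p n
  have "\<forall>i\<in>J. \<exists>q. separates i (fst q) (snd q)"
  proof
    fix i assume i: "i \<in> J"
    obtain c k where ck: "i = (c, k)" by (cases i)
    have c: "c \<in> carrier C" "\<And>b d. b \<in> carrier B \<Longrightarrow> d \<in> carrier C \<Longrightarrow> c \<noteq> b \<otimes>\<^bsub>C\<^esub> d [^]\<^bsub>C\<^esub> k"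
      using i unfolding J_def ck by auto
    show "\<exists>q. separates i (fst q) (snd q)"
    proof (rule cocyclic_separation[where 'g = 'c, OF C'(1) BC'(4) c])
      fix p n
      assume pn: "prime p"
        "\<And>G :: 'c monoid. cocyclic_of_type p n G \<Longrightarrow>
           \<exists>\<phi>\<in>hom C G. (\<forall>x\<in>carrier B. \<phi> x = \<one>\<^bsub>G\<^esub>) \<and> \<phi> c \<noteq> \<one>\<^bsub>G\<^esub>"
        "\<And>(G :: 'c monoid) y. cocyclic_of_type p n G \<Longrightarrow> 1 \<le> k \<Longrightarrow> y \<in> carrier G \<Longrightarrow> y [^]\<^bsub>G\<^esub> k = \<one>\<^bsub>G\<^esub>"
      show ?thesis
        unfolding separates_def by (rule exI[of _ "(p, n)"]) (use pn ck in simp)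
    qed
  qed
  from bchoice[OF this] obtain q where q: "\<And>i. i \<in> J \<Longrightarrow> separates i (fst (q i)) (snd (q i))"
    by blast
  define pp nn where "pp = fst \<circ> q" and "nn = snd \<circ> q"
  have pp: "prime (pp i)"
    and sep: "cocyclic_of_type (pp i) (nn i) G \<Longrightarrow>
       \<exists>\<phi>\<in>hom C G. (\<forall>x\<in>carrier B. \<phi> x = \<one>\<^bsub>G\<^esub>) \<and> \<phi> (fst i) \<noteq> \<one>\<^bsub>G\<^esub>"
    and expo: "cocyclic_of_type (pp i) (nn i) G \<Longrightarrow> snd i \<ge> 1 \<Longrightarrow>
       y \<in> carrier G \<Longrightarrow> y [^]\<^bsub>G\<^esub> (snd i) = \<one>\<^bsub>G\<^esub>" if "i \<in> J" for i y and G :: "'c monoid"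
    using q[OF that] unfolding separates_def pp_def nn_def by auto
  define T where "T i = {\<alpha> \<in> Field \<kappa>. cocyclic_of_type (pp i) (nn i) (H \<alpha>)}" for i
  have "\<not> small (T i)" if "i \<in> J" for i
    unfolding T_def using pp[OF that] by (rule not_small_type)
  then obtain t where t': "inj_on t J" "\<And>i. i \<in> J \<Longrightarrow> t i \<in> T i - S"
    using injective_selection[OF J S, of T] by blast
  note t = t'[unfolded T_def]
  \<comment> \<open>Triviality outside S and the selected coordinates keeps the supports of the
    values of g small. Selected coordinates avoid S, so extending f there just means killing
    B.\<close>
  define coordinate where "coordinate \<alpha> h \<longleftrightarrow> h \<in> hom C (H \<alpha>) \<and> (\<forall>b\<in>carrier B. h b = f b \<alpha>) \<and>
      (\<forall>i\<in>J. t i = \<alpha> \<longrightarrow> h (fst i) \<noteq> \<one>\<^bsub>H \<alpha>\<^esub>) \<and>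
      (\<alpha> \<notin> S \<union> t ` J \<longrightarrow> (\<forall>c\<in>carrier C. h c = \<one>\<^bsub>H \<alpha>\<^esub>))" for \<alpha> h
  have "\<forall>\<alpha>\<in>Field \<kappa>. \<exists>h. coordinate \<alpha> h"
  proof
    fix \<alpha> assume \<alpha>: "\<alpha> \<in> Field \<kappa>"
    have f1: "f b \<alpha> = \<one>\<^bsub>H \<alpha>\<^esub>" if "b \<in> carrier B" "\<alpha> \<notin> S" for b
      using that \<alpha> unfolding S_def supp_def by blast
    consider (support) "\<alpha> \<in> S" | (selected) i where "i \<in> J" "\<alpha> = t i" | (trivial) "\<alpha> \<notin> S \<union> t ` J"
      by blast
    then show "\<exists>h. coordinate \<alpha> h"
    proof cases
      case support
      obtain p n where pn: "prime p" "cocyclic_of_type p n (H \<alpha>)"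
        by (rule coordinate_type[OF \<alpha>])
      obtain h where "h \<in> hom C (H \<alpha>)" "\<And>x. x \<in> carrier B \<Longrightarrow> h x = f x \<alpha>"
        using cocyclic_hom_extend[OF pn B'(1) C'(1) BC f\<alpha>[OF \<alpha>]] by blast
      moreover have "t i \<noteq> \<alpha>" if "i \<in> J" for i
        using t(2)[OF that] support by auto
      ultimately show ?thesis
        using support unfolding coordinate_def by (intro exI[of _ h]) auto
    next
      case selected
      then have "cocyclic_of_type (pp i) (nn i) (H \<alpha>)" "\<alpha> \<notin> S"
        using t(2) by auto
      then obtain \<phi> where \<phi>: "\<phi> \<in> hom C (H \<alpha>)" "\<forall>x\<in>carrier B. \<phi> x = \<one>\<^bsub>H \<alpha>\<^esub>" "\<phi> (fst i) \<noteq> \<one>\<^bsub>H \<alpha>\<^esub>"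
        using sep[OF selected(1)] by blast
      have "j = i" if "j \<in> J" "t j = \<alpha>" for j
        using inj_onD[OF t(1)] that selected by blast
      then have "\<forall>j\<in>J. t j = \<alpha> \<longrightarrow> \<phi> (fst j) \<noteq> \<one>\<^bsub>H \<alpha>\<^esub>"
        using \<phi>(3) by metis
      moreover have "\<forall>b\<in>carrier B. \<phi> b = f b \<alpha>"
        using \<phi>(2) f1[OF _ \<open>\<alpha> \<notin> S\<close>] by simp
      moreover have "\<alpha> \<in> S \<union> t ` J"
        using selected by blast
      ultimately have "coordinate \<alpha> \<phi>"
        unfolding coordinate_def using \<phi>(1) by blast
      then show ?thesis by blast
    next
      case trivial
      have "(\<lambda>_. \<one>\<^bsub>H \<alpha>\<^esub>) \<in> hom C (H \<alpha>)"
        using coordinate_group(2)[OF \<alpha>] by (auto simp: hom_def group.is_monoid monoid.one_closed)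
      then show ?thesis
        using trivial f1 unfolding coordinate_def by (intro exI[of _ "\<lambda>_. \<one>\<^bsub>H \<alpha>\<^esub>"]) (simp add: image_iff, blast)
    qed
  qed
  from bchoice[OF this] obtain h where "\<And>\<alpha>. \<alpha> \<in> Field \<kappa> \<Longrightarrow> coordinate \<alpha> (h \<alpha>)"
    by blast
  then have h: "\<And>\<alpha>. \<alpha> \<in> Field \<kappa> \<Longrightarrow> h \<alpha> \<in> hom C (H \<alpha>)"
    "\<And>\<alpha> b. \<alpha> \<in> Field \<kappa> \<Longrightarrow> b \<in> carrier B \<Longrightarrow> h \<alpha> b = f b \<alpha>"
    "\<And>i. t i \<in> Field \<kappa> \<Longrightarrow> i \<in> J \<Longrightarrow> h (t i) (fst i) \<noteq> \<one>\<^bsub>H (t i)\<^esub>"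
    "\<And>\<alpha> c. \<alpha> \<in> Field \<kappa> \<Longrightarrow> \<alpha> \<notin> S \<union> t ` J \<Longrightarrow> c \<in> carrier C \<Longrightarrow> h \<alpha> c = \<one>\<^bsub>H \<alpha>\<^esub>"
    unfolding coordinate_def by blast+
  define g where "g c = (\<lambda>\<alpha>\<in>Field \<kappa>. h \<alpha> c)" for c
  have ht: "g (fst i) (t i) \<noteq> \<one>\<^bsub>H (t i)\<^esub>" if "i \<in> J" for i
    using h(3)[OF _ that] t(2)[OF that] by (simp add: g_def)
  have gP: "g c \<in> carrier P" if c: "c \<in> carrier C" for c
  proof -
    have "supp (g c) \<subseteq> S \<union> t ` J"
      using h(4)[OF _ _ c] by (auto simp: supp_def g_def)
    then have "small (supp (g c))"
      using small_subset[OF small_Un[OF S small_image[OF J]]] by blast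
    moreover have "g c \<in> (\<Pi>\<^sub>E \<alpha>\<in>Field \<kappa>. carrier (H \<alpha>))"
      using hom_in_carrier[OF h(1) c] by (auto simp: g_def)
    ultimately show ?thesis
      unfolding P_simps by blast
  qed
  have g_hom: "g \<in> hom C P"
  proof (rule homI)
    show "g (x \<otimes>\<^bsub>C\<^esub> y) = g x \<otimes>\<^bsub>P\<^esub> g y" if "x \<in> carrier C" "y \<in> carrier C" for x y
      unfolding P_simps g_def using hom_mult[OF h(1)] that by (auto intro!: restrict_ext)
  qed (rule gP)
  interpret g: group_hom C P g
    using g_hom C'(2) group_P by (simp add: group_hom_def group_hom_axioms_def)
  have gf: "g b = f b" if b: "b \<in> carrier B" for b
  proof (rule P_ext)
    show "g b \<in> carrier P" "f b \<in> carrier P"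
      using gP fP b BC'(1) by auto
    show "g b \<alpha> = f b \<alpha>" if "\<alpha> \<in> Field \<kappa>" for \<alpha>
      using h(2)[OF that b] that by (simp add: g_def)
  qed
  have f_inj: "inj_on f (carrier B)"
    using f by (rule pure_embedding_inj_on)
  have f_one: "f \<one>\<^bsub>B\<^esub> = \<one>\<^bsub>P\<^esub>"
    using hom_one[OF f_hom B'(2) group_P] .
  have "inj_on g (carrier C)"
    unfolding g.inj_on_one_iff
  proof (intro allI impI)
    fix c assume c: "c \<in> carrier C" and gc: "g c = \<one>\<^bsub>P\<^esub>"
    have "c \<in> carrier B"
    proof (rule ccontr)
      assume "c \<notin> carrier B"
      then have i: "(c, 0) \<in> J"
        using c BC'(1) by (auto simp: J_def)
      then show False
        using ht[OF i] gc t(2)[OF i] by (simp add: P_simps(3))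
    qed
    moreover from this have "f c = f \<one>\<^bsub>B\<^esub>"
      using gf[of c] gc f_one by simp
    ultimately have "c = \<one>\<^bsub>B\<^esub>"
      using inj_onD[OF f_inj] B.one_closed by blast
    then show "c = \<one>\<^bsub>C\<^esub>"
      using BC'(2) by simp
  qed
  moreover have "\<exists>a'\<in>carrier C. c = a' [^]\<^bsub>C\<^esub> k"
    if c: "c \<in> carrier C" and k: "k \<ge> 1" and y: "\<exists>y\<in>carrier P. g c = y [^]\<^bsub>P\<^esub> k" for c and k :: nat
  proof -
    obtain y where y: "y \<in> carrier P" "g c = y [^]\<^bsub>P\<^esub> k"
      using y by blast
    have "(c, k) \<notin> J"
    proof
      assume i: "(c, k) \<in> J"
      then have \<alpha>: "t (c, k) \<in> Field \<kappa>" "cocyclic_of_type (pp (c, k)) (nn (c, k)) (H (t (c, k)))"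
        using t(2) by auto
      \<comment> \<open>The type reserved for (c, k) is annihilated by k, whereas g c does not
        vanish at this coordinate.\<close>
      have "y (t (c, k)) [^]\<^bsub>H (t (c, k))\<^esub> k = \<one>\<^bsub>H (t (c, k))\<^esub>"
        using expo[OF i \<alpha>(2)] k P_coordinate[OF y(1) \<alpha>(1)] by simp
      then show False
        using ht[OF i] y(2) P_pow[OF \<alpha>(1) y(1)] by simp
    qed
    then obtain b d where bd: "b \<in> carrier B" "d \<in> carrier C" "c = b \<otimes>\<^bsub>C\<^esub> d [^]\<^bsub>C\<^esub> k"
      using c unfolding J_def by blast
    have b: "b \<in> carrier C"
      using bd(1) BC'(1) by blast
    \<comment> \<open>Solving for b shows that g b, which equals f b, is a k-th multiple in P;
      purity of f then gives b = kb' with b' in B, hence c = k(b' + d).\<close>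
    have "b = c \<otimes>\<^bsub>C\<^esub> (inv\<^bsub>C\<^esub> d) [^]\<^bsub>C\<^esub> k"
      using bd b by (simp add: C.nat_pow_inv C.m_assoc)
    then have "g b = (y \<otimes>\<^bsub>P\<^esub> g (inv\<^bsub>C\<^esub> d)) [^]\<^bsub>P\<^esub> k"
      using y c bd(2) gP by (simp add: g.hom_nat_pow P.nat_pow_distrib del: g.hom_inv)
    then have "\<exists>y\<in>carrier P. f b = y [^]\<^bsub>P\<^esub> k"
      using gf[OF bd(1)] y(1) gP[OF C.inv_closed[OF bd(2)]] P.m_closed by metis
    then obtain b' where b': "b' \<in> carrier B" "b = b' [^]\<^bsub>B\<^esub> k"
      using f k bd(1) unfolding pure_embedding_iff[OF B'(2) group_P] by blast
    then have "b' \<in> carrier C" "b = b' [^]\<^bsub>C\<^esub> k"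
      using BC'(1) pure_subgroup_pow(1)[OF BC b'(1)] by auto
    then show ?thesis
      using bd by (intro bexI[of _ "b' \<otimes>\<^bsub>C\<^esub> d"]) (simp_all add: C.nat_pow_distrib)
  qed
  ultimately have "pure_embedding g C P"
    unfolding pure_embedding_iff[OF C'(2) group_P] using g_hom by blast
  then show "\<exists>g. pure_embedding g C P \<and> (\<forall>x\<in>carrier B. g x = f x)"
    using gf by blast
qed

end


subsection \<open>The Fraisse class of small groups\<close>

text \<open>Comparable groups agree wherever both are defined, so the definite descriptions in
  \<open>union_group\<close> denote. For purity, a root in A j either already lies in A i or, A i
  being pure in A j, can be replaced by one in A i.\<close>

lemma union_group_directed:
  fixes A :: "'i \<Rightarrow> 'a monoid"
  assumes "I \<noteq> {}" and A: "\<And>i. i \<in> I \<Longrightarrow> comm_group (A i)"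
    and comparable: "\<And>i j. i \<in> I \<Longrightarrow> j \<in> I \<Longrightarrow> pure_subgroup (A i) (A j) \<or> pure_subgroup (A j) (A i)"
  shows "comm_group (union_group I A)" "\<And>i. i \<in> I \<Longrightarrow> pure_subgroup (A i) (union_group I A)"
proof -
  define U where "U = union_group I A"
  have grp: "group (A i)" "monoid (A i)" if "i \<in> I" for i
    using A[OF that] by (auto simp: comm_group_def group.is_monoid)
  have U_carrier: "carrier U = (\<Union>i\<in>I. carrier (A i))"
    by (simp add: U_def union_group_def)
  have one_eq: "\<one>\<^bsub>A i\<^esub> = \<one>\<^bsub>A j\<^esub>" if "i \<in> I" "j \<in> I" for i j
    using comparable[OF that] pure_subgroup_eq(2) by metis
  have U_one: "\<one>\<^bsub>U\<^esub> = \<one>\<^bsub>A i\<^esub>" if "i \<in> I" for i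
  proof -
    have "(THE e. \<exists>i\<in>I. e = \<one>\<^bsub>A i\<^esub>) = \<one>\<^bsub>A i\<^esub>"
      by (rule the_equality) (use that one_eq in blast)+
    then show ?thesis by (simp add: U_def union_group_def)
  qed
  have mult_eq: "x \<otimes>\<^bsub>A i\<^esub> y = x \<otimes>\<^bsub>A j\<^esub> y"
    if "i \<in> I" "j \<in> I" "x \<in> carrier (A i)" "y \<in> carrier (A i)" "x \<in> carrier (A j)" "y \<in> carrier (A j)" for i j x y
    using comparable[OF that(1,2)] pure_subgroup_eq(3) that(3-) by metis
  have U_mult: "x \<otimes>\<^bsub>U\<^esub> y = x \<otimes>\<^bsub>A i\<^esub> y"
    if "i \<in> I" "x \<in> carrier (A i)" "y \<in> carrier (A i)" for i x y
  proof -
    have "(THE z. \<exists>i\<in>I. x \<in> carrier (A i) \<and> y \<in> carrier (A i) \<and> z = x \<otimes>\<^bsub>A i\<^esub> y) = x \<otimes>\<^bsub>A i\<^esub> y"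
      by (rule the_equality) (use that mult_eq in blast)+
    then show ?thesis by (simp add: U_def union_group_def)
  qed
  have larger: "\<exists>k\<in>{i, j}. carrier (A i) \<subseteq> carrier (A k) \<and> carrier (A j) \<subseteq> carrier (A k)"
    if "i \<in> I" "j \<in> I" for i j
    using comparable[OF that] pure_subgroup_eq(1) by blast
  have common: "\<exists>i\<in>I. x \<in> carrier (A i) \<and> y \<in> carrier (A i)" if xy: "x \<in> carrier U" "y \<in> carrier U" for x y
  proof -
    obtain i j where ij: "i \<in> I" "x \<in> carrier (A i)" "j \<in> I" "y \<in> carrier (A j)"
      using xy unfolding U_carrier by blast
    then show ?thesis using larger[OF ij(1,3)] by blast
  qed
  have common3: "\<exists>i\<in>I. x \<in> carrier (A i) \<and> y \<in> carrier (A i) \<and> z \<in> carrier (A i)"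
    if xyz: "x \<in> carrier U" "y \<in> carrier U" "z \<in> carrier U" for x y z
  proof -
    obtain i j where ij: "i \<in> I" "x \<in> carrier (A i)" "y \<in> carrier (A i)" "j \<in> I" "z \<in> carrier (A j)"
      using common[OF xyz(1,2)] xyz(3) unfolding U_carrier by blast
    then show ?thesis using larger[OF ij(1,4)] by blast
  qed
  have AU: "x \<in> carrier U" if "i \<in> I" "x \<in> carrier (A i)" for i x
    using that unfolding U_carrier by blast
  show comm: "comm_group (union_group I A)"
    unfolding U_def[symmetric]
  proof (rule comm_groupI)
    fix x y assume "x \<in> carrier U" "y \<in> carrier U"
    then obtain i where i: "i \<in> I" "x \<in> carrier (A i)" "y \<in> carrier (A i)"
      using common by blast
    interpret A: comm_group "A i" by (rule A[OF i(1)])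
    show "x \<otimes>\<^bsub>U\<^esub> y \<in> carrier U"
      using AU[OF i(1)] i U_mult by simp
    show "x \<otimes>\<^bsub>U\<^esub> y = y \<otimes>\<^bsub>U\<^esub> x"
      using i U_mult A.m_comm by simp
  next
    obtain i where i: "i \<in> I"
      using \<open>I \<noteq> {}\<close> by blast
    then show "\<one>\<^bsub>U\<^esub> \<in> carrier U"
      using U_one[OF i] AU[OF i] monoid.one_closed[OF grp(2)[OF i]] by simp
  next
    fix x y z assume "x \<in> carrier U" "y \<in> carrier U" "z \<in> carrier U"
    then obtain i where i: "i \<in> I" "x \<in> carrier (A i)" "y \<in> carrier (A i)" "z \<in> carrier (A i)"
      using common3 by blast
    interpret A: comm_group "A i" by (rule A[OF i(1)])
    show "x \<otimes>\<^bsub>U\<^esub> y \<otimes>\<^bsub>U\<^esub> z = x \<otimes>\<^bsub>U\<^esub> (y \<otimes>\<^bsub>U\<^esub> z)"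
      using i U_mult[OF i(1)] A.m_assoc by simp
  next
    fix x assume "x \<in> carrier U"
    then obtain i where i: "i \<in> I" "x \<in> carrier (A i)"
      unfolding U_carrier by blast
    interpret A: comm_group "A i" by (rule A[OF i(1)])
    show "\<one>\<^bsub>U\<^esub> \<otimes>\<^bsub>U\<^esub> x = x"
      using i U_mult[OF i(1)] U_one[OF i(1)] by simp
    have "inv\<^bsub>A i\<^esub> x \<otimes>\<^bsub>U\<^esub> x = \<one>\<^bsub>U\<^esub>"
      using i U_mult[OF i(1)] U_one[OF i(1)] by simp
    then show "\<exists>y\<in>carrier U. y \<otimes>\<^bsub>U\<^esub> x = \<one>\<^bsub>U\<^esub>"
      using AU[OF i(1) A.inv_closed[OF i(2)]] by blast
  qed
  interpret U: comm_group U
    using comm unfolding U_def .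
  have U_pow: "x [^]\<^bsub>U\<^esub> k = x [^]\<^bsub>A i\<^esub> k" if "i \<in> I" "x \<in> carrier (A i)" for i x and k :: nat
    using U_one[OF that(1)] U_mult[OF that(1)] that(2) monoid.nat_pow_closed[OF grp(2)[OF that(1)] that(2)]
    by (induction k) auto
  show "pure_subgroup (A i) (union_group I A)" if i: "i \<in> I" for i
  proof -
    interpret A: comm_group "A i" by (rule A[OF i])
    have "subgroup (carrier (A i)) U"
    proof (rule U.subgroupI)
      show "carrier (A i) \<subseteq> carrier U" "carrier (A i) \<noteq> {}"
        using AU[OF i] A.one_closed by blast+
    next
      fix x assume x: "x \<in> carrier (A i)"
      have "inv\<^bsub>U\<^esub> x = inv\<^bsub>A i\<^esub> x"
        using x U_mult[OF i] U_one[OF i] AU[OF i] by (intro U.inv_equality) auto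
      then show "inv\<^bsub>U\<^esub> x \<in> carrier (A i)"
        using x by simp
    qed (simp add: U_mult[OF i])
    moreover have "\<exists>a'\<in>carrier (A i). a = a' [^]\<^bsub>U\<^esub> k"
      if a: "a \<in> carrier (A i)" and k: "k \<ge> 1" and b: "\<exists>b\<in>carrier U. a = b [^]\<^bsub>U\<^esub> k" for a and k :: nat
    proof -
      obtain b j where bj: "a = b [^]\<^bsub>U\<^esub> k" "j \<in> I" "b \<in> carrier (A j)"
        using b unfolding U_carrier by blast
      show ?thesis
        using comparable[OF i bj(2)]
      proof
        assume ij: "pure_subgroup (A i) (A j)"
        have "a = b [^]\<^bsub>A j\<^esub> k"
          using bj U_pow by simp
        from pure_subgroup_root[OF ij a bj(3) this k] show ?thesis
          using U_pow[OF i] by metis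
      next
        assume "pure_subgroup (A j) (A i)"
        then have "b \<in> carrier (A i)"
          using pure_subgroup_eq(1) bj(3) by blast
        then show ?thesis using bj(1) by blast
      qed
    qed
    ultimately show ?thesis
      using U_one[OF i] U_mult[OF i] unfolding pure_subgroup_def pure_subset_def U_def[symmetric] by simp
  qed
qed

lemma pure_embedding_restrict_range:
  assumes F: "group F" and e: "pure_embedding e B F" and T: "subgroup T F" and eT: "e ` carrier B \<subseteq> T"
  shows "pure_embedding e B (F\<lparr>carrier := T\<rparr>)"
  using pure_embedding_hom[OF e] pure_embedding_inj_on[OF e] eT
    pure_subset_restrict[OF F pure_embedding_image[OF e] T eT]
  unfolding pure_embedding_def by (auto simp: hom_def)

lemma pure_embedding_trivial:
  assumes "group A" "group B"
  shows "pure_embedding (\<lambda>_. \<one>\<^bsub>B\<^esub>) (A\<lparr>carrier := {\<one>\<^bsub>A\<^esub>}\<rparr>) B"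
  using pure_subset_one[OF assms(2)] assms
  unfolding pure_embedding_def by (auto simp: hom_def group.is_monoid monoid.one_closed)

lemma pure_injective_forE:
  assumes "pure_injective_for F K" "B \<in> K" "C \<in> K" "pure_subgroup B C" "pure_embedding f B F"
  obtains g where "pure_embedding g C F" "\<And>x. x \<in> carrier B \<Longrightarrow> g x = f x"
proof -
  have "\<exists>g. pure_embedding g C F \<and> (\<forall>x\<in>carrier B. g x = f x)"
    using assms unfolding pure_injective_for_def by simp
  then show ?thesis using that by blast
qed

lemma amalgamationE:
  assumes "amalgamation K" "A \<in> K" "B \<in> K" "C \<in> K" "pure_embedding f A B" "pure_embedding g A C"
  obtains D f' g' where "D \<in> K" "pure_embedding f' B D" "pure_embedding g' C D"
    "\<And>x. x \<in> carrier A \<Longrightarrow> f' (f x) = g' (g x)"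
proof -
  have "\<exists>D\<in>K. \<exists>f' g'. pure_embedding f' B D \<and> pure_embedding g' C D \<and>
      (\<forall>x\<in>carrier A. f' (f x) = g' (g x))"
    using assms(1)[unfolded amalgamation_def, rule_format, OF assms(2-4) conjI[OF assms(5,6)]] .
  then show ?thesis using that by blast
qed

context inaccessible
begin

lemma trivial_subgroup_small:
  assumes "B \<in> small_groups \<kappa>"
  shows "B\<lparr>carrier := {\<one>\<^bsub>B\<^esub>}\<rparr> \<in> small_groups \<kappa>" "pure_subgroup (B\<lparr>carrier := {\<one>\<^bsub>B\<^esub>}\<rparr>) B"
proof -
  note B = small_groupsD[OF assms]
  show "pure_subgroup (B\<lparr>carrier := {\<one>\<^bsub>B\<^esub>}\<rparr>) B"
    by (rule pure_subgroup_restrict[OF pure_subset_one[OF B(2)]])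
  then have "comm_group (B\<lparr>carrier := {\<one>\<^bsub>B\<^esub>}\<rparr>)"
    by (rule comm_group_pure_subgroup[OF B(1)])
  then show "B\<lparr>carrier := {\<one>\<^bsub>B\<^esub>}\<rparr> \<in> small_groups \<kappa>"
    using small_countable[of "{\<one>\<^bsub>B\<^esub>}"] by (simp add: small_groups_def)
qed

text \<open>Extend the embedding of the trivial subgroup of B.\<close>

lemma pure_injective_universal:
  fixes B :: "'x monoid"
  assumes F: "comm_group F" and inj: "pure_injective_for F (small_groups \<kappa> :: 'x monoid set)" and B: "B \<in> small_groups \<kappa>"
  obtains e where "pure_embedding e B F"
proof -
  have "pure_embedding (\<lambda>_. \<one>\<^bsub>F\<^esub>) (B\<lparr>carrier := {\<one>\<^bsub>B\<^esub>}\<rparr>) F"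
    using F small_groupsD(2)[OF B] by (simp add: pure_embedding_trivial comm_group_def)
  from pure_injective_forE[OF inj trivial_subgroup_small(1)[OF B] B trivial_subgroup_small(2)[OF B] this]
  show ?thesis using that by blast
qed

text \<open>Embed B into F by some e, transport e \<circ> f to the image of A in C, and extend it to
  h on C; the square commutes by construction. F need not be small, so the amalgam is a small pure
  subgroup of F containing both images, and images pure in F stay pure in it.\<close>

lemma amalgamation_small_groups:
  fixes F :: "'a monoid"
  assumes F: "comm_group F" and inj: "pure_injective_for F (small_groups \<kappa> :: 'a monoid set)"
  shows "amalgamation (small_groups \<kappa> :: 'a monoid set)"
  unfolding amalgamation_def
proof (intro ballI allI impI, elim conjE)
  fix A B C :: "'a monoid" and f g
  assume A: "A \<in> small_groups \<kappa>" and B: "B \<in> small_groups \<kappa>" and C: "C \<in> small_groups \<kappa>"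
    and f: "pure_embedding f A B" and g: "pure_embedding g A C"
  note A' = small_groupsD[OF A] and B' = small_groupsD[OF B] and C' = small_groupsD[OF C]
  have F': "group F"
    using F by (simp add: comm_group_def)
  obtain e where e: "pure_embedding e B F"
    by (rule pure_injective_universal[OF F inj B])
  \<comment> \<open>The image of A stands in for A because pure-injectivity asks for an actual
    subgroup of C.\<close>
  define A1 where "A1 = C\<lparr>carrier := g ` carrier A\<rparr>"
  have A1C: "pure_subgroup A1 C"
    unfolding A1_def by (rule pure_subgroup_restrict[OF pure_embedding_image[OF g]])
  have A1: "comm_group A1" "group A1"
    using comm_group_pure_subgroup[OF C'(1) A1C] by (auto simp: comm_group_def)
  then have A1K: "A1 \<in> small_groups \<kappa>"
    using small_image[OF A'(3)] by (simp add: small_groups_def A1_def)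
  have "g \<in> iso A A1"
    using pure_embedding_hom[OF g] pure_embedding_inj_on[OF g]
    by (auto simp: iso_def hom_def bij_betw_def A1_def)
  then have g': "inv_into (carrier A) g \<in> iso A1 A"
    by (rule group.iso_set_sym[OF A'(2)])
  have "pure_embedding ((e \<circ> f) \<circ> inv_into (carrier A) g) A1 F"
    using pure_embedding_compose[OF A1(2) A'(2) F' iso_imp_pure_embedding[OF A1(2) A'(2) g']
        pure_embedding_compose[OF A'(2) B'(2) F' f e]] .
  then obtain h where h: "pure_embedding h C F"
    "\<And>x. x \<in> carrier A1 \<Longrightarrow> h x = ((e \<circ> f) \<circ> inv_into (carrier A) g) x"
    using inj A1K C A1C unfolding pure_injective_for_def by blast
  have "e ` carrier B \<union> h ` carrier C \<subseteq> carrier F"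
    using hom_carrier[OF pure_embedding_hom[OF e]] hom_carrier[OF pure_embedding_hom[OF h(1)]] by blast
  moreover have "small (e ` carrier B \<union> h ` carrier C)"
    using small_Un[OF small_image[OF B'(3)] small_image[OF C'(3)]] .
  ultimately obtain T where T: "pure_subset T F" "e ` carrier B \<union> h ` carrier C \<subseteq> T" "small T"
    by (rule pure_closure[OF F'])
  have Tsub: "subgroup T F"
    using T(1) by (rule pure_subset_subgroup)
  have D: "F\<lparr>carrier := T\<rparr> \<in> small_groups \<kappa>"
    using comm_group_subgroup[OF F Tsub] T(3) by (simp add: small_groups_def)
  have eD: "pure_embedding e B (F\<lparr>carrier := T\<rparr>)"
    by (rule pure_embedding_restrict_range[OF F' e Tsub]) (use T(2) in blast)
  have hD: "pure_embedding h C (F\<lparr>carrier := T\<rparr>)"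
    by (rule pure_embedding_restrict_range[OF F' h(1) Tsub]) (use T(2) in blast)
  have "\<forall>x\<in>carrier A. e (f x) = h (g x)"
    using h(2) pure_embedding_inj_on[OF g] by (simp add: A1_def)
  with eD hD have "\<exists>f' g'. pure_embedding f' B (F\<lparr>carrier := T\<rparr>) \<and>
      pure_embedding g' C (F\<lparr>carrier := T\<rparr>) \<and> (\<forall>x\<in>carrier A. f' (f x) = g' (g x))"
    by blast
  then show "\<exists>D\<in>(small_groups \<kappa> :: 'a monoid set). \<exists>f' g'. pure_embedding f' B D \<and> pure_embedding g' C D \<and>
      (\<forall>x\<in>carrier A. f' (f x) = g' (g x))"
    using D by (rule bexI)
qed

text \<open>Amalgamate over the trivial subgroup of A, which embeds purely into both groups.\<close>

lemma amalgamation_imp_joint_embedding: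
  assumes "amalgamation (small_groups \<kappa> :: 'a monoid set)"
  shows "joint_embedding (small_groups \<kappa> :: 'a monoid set)"
  unfolding joint_embedding_def
proof (intro ballI)
  fix A B :: "'a monoid" assume A: "A \<in> small_groups \<kappa>" and B: "B \<in> small_groups \<kappa>"
  note A' = small_groupsD[OF A] and B' = small_groupsD[OF B] and A0 = trivial_subgroup_small[OF A]
  show "\<exists>C\<in>(small_groups \<kappa> :: 'a monoid set). (\<exists>f. pure_embedding f A C) \<and> (\<exists>g. pure_embedding g B C)"
  proof (rule amalgamationE[OF assms A0(1) A B pure_embedding_trivial[OF A'(2) A'(2)] pure_embedding_trivial[OF A'(2) B'(2)]])
    fix D :: "'a monoid" and f' g'
    assume "D \<in> small_groups \<kappa>" "pure_embedding f' A D" "pure_embedding g' B D"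
    then show ?thesis by blast
  qed
qed

lemma closed_under_pure_subgroups_small_groups:
  "closed_under_pure_subgroups (small_groups \<kappa>)"
  unfolding closed_under_pure_subgroups_def
proof (intro ballI allI impI)
  fix A B :: "'a monoid" assume B: "B \<in> small_groups \<kappa>" and AB: "pure_subgroup A B"
  note B' = small_groupsD[OF B]
  show "A \<in> small_groups \<kappa>"
    using comm_group_pure_subgroup[OF B'(1) AB] small_subset[OF B'(3) pure_subgroup_eq(1)[OF AB]]
    by (simp add: small_groups_def)
qed

text \<open>Any two members of the chain are comparable, so \<open>union_group_directed\<close>
  applies; smallness of the union is regularity of \<kappa>.\<close>

lemma chain_closed_small_groups: "chain_closed \<kappa> (small_groups \<kappa> :: 'a monoid set)"
  unfolding chain_closed_def
proof (intro allI impI, elim conjE)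
  fix \<delta> and A :: "'k \<Rightarrow> 'a monoid"
  assume \<delta>: "limit_point \<kappa> \<delta>" and A: "\<forall>\<alpha>\<in>underS \<kappa> \<delta>. A \<alpha> \<in> small_groups \<kappa>"
    and pure: "\<forall>\<beta>\<in>underS \<kappa> \<delta>. \<forall>\<alpha>\<in>underS \<kappa> \<beta>. pure_subgroup (A \<alpha>) (A \<beta>)"
  have \<delta>': "\<delta> \<in> Field \<kappa>" "underS \<kappa> \<delta> \<noteq> {}"
    using \<delta> unfolding limit_point_def by auto
  have comm: "comm_group (A \<alpha>)" if "\<alpha> \<in> underS \<kappa> \<delta>" for \<alpha>
    using A that small_groupsD(1) by blast
  have comparable: "pure_subgroup (A \<alpha>) (A \<beta>) \<or> pure_subgroup (A \<beta>) (A \<alpha>)"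
    if "\<alpha> \<in> underS \<kappa> \<delta>" "\<beta> \<in> underS \<kappa> \<delta>" for \<alpha> \<beta>
  proof -
    have "\<alpha> \<in> Field \<kappa>" "\<beta> \<in> Field \<kappa>"
      using that by (auto simp: underS_def Field_def)
    then consider "\<alpha> = \<beta>" | "\<alpha> \<in> underS \<kappa> \<beta>" | "\<beta> \<in> underS \<kappa> \<alpha>"
      using wo_rel.TOTALS[OF wo_rel] unfolding underS_def by blast
    then show ?thesis
    proof cases
      case 1
      have "subgroup (carrier (A \<alpha>)) (A \<alpha>)"
        using comm[OF that(1)] by (simp add: comm_group_def group.subgroup_self)
      then show ?thesis
        using 1 by (simp add: pure_subgroup_def pure_subset_def)
    qed (use pure that in blast)+
  qed
  note U = union_group_directed[of "underS \<kappa> \<delta>" A, OF \<delta>'(2) comm comparable]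
  have "small (\<Union>\<alpha>\<in>underS \<kappa> \<delta>. carrier (A \<alpha>))"
    by (rule small_UN[OF small_underS[OF \<delta>'(1)]]) (use A small_groupsD(3) in blast)
  then have "union_group (underS \<kappa> \<delta>) A \<in> small_groups \<kappa>"
    using U(1) by (simp add: small_groups_def union_group_def)
  then show "union_group (underS \<kappa> \<delta>) A \<in> small_groups \<kappa> \<and>
      (\<forall>\<alpha>\<in>underS \<kappa> \<delta>. pure_subgroup (A \<alpha>) (union_group (underS \<kappa> \<delta>) A))"
    using U(2) by blast
qed

lemma fraisse_class_small_groups:
  fixes F :: "'a monoid"
  assumes "comm_group F" "pure_injective_for F (small_groups \<kappa> :: 'a monoid set)"
  shows "fraisse_class \<kappa> (small_groups \<kappa> :: 'a monoid set)"
  unfolding fraisse_class_def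
  using amalgamation_small_groups[OF assms] amalgamation_imp_joint_embedding
    closed_under_pure_subgroups_small_groups chain_closed_small_groups by blast

text \<open>Since \<kappa> absorbs countable factors, \<open>Field \<kappa>\<close> can be
  identified with its product with the set of all pairs (p, n). The second component names the type,
  so each type is met at least once for every element of \<open>Field \<kappa>\<close>.\<close>

lemma cocyclic_family_exists: "\<exists>H :: 'k \<Rightarrow> complex monoid. cocyclic_family \<kappa> H"
proof -
  have "|UNIV :: (nat \<times> enat) set| \<le>o |Field \<kappa>|"
    using small_countable[of "UNIV :: (nat \<times> enat) set"] card_of_Field_ordIso[OF card_order]
    by (intro ordLess_imp_ordLeq[OF ordLess_ordIso_trans[OF _ ordIso_symmetric]]) auto
  then have "|Field \<kappa>| =o |Field \<kappa> \<times> (UNIV :: (nat \<times> enat) set)|"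
    using card_of_Times_infinite[OF infinite_Field, of "UNIV :: (nat \<times> enat) set"] ordIso_symmetric by blast
  then obtain \<phi> where \<phi>: "bij_betw \<phi> (Field \<kappa>) (Field \<kappa> \<times> (UNIV :: (nat \<times> enat) set))"
    using iffD2[OF card_of_ordIso] by blast
  \<comment> \<open>Pairs whose first component is not prime receive the quasi-cyclic 2-group as a
    filler; extra copies of a type do no harm.\<close>
  define G where "G q = (if prime (fst q) then roots_group (fst q) (cocyclic_exponent (fst q) (snd q))
    else roots_group 2 (cocyclic_exponent 2 \<infinity>))" for q
  define H where "H \<alpha> = G (snd (\<phi> \<alpha>))" for \<alpha>
  have G: "cocyclic_of_type p n (G (p, n))" if "prime p" for p n
    using that comm_group_roots by (simp add: cocyclic_of_type_iff G_def iso_refl)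
  have "cocyclic (G q)" for q
  proof (cases "prime (fst q)")
    case True
    then show ?thesis
      using G[of "fst q" "snd q"] unfolding cocyclic_def by auto
  next
    case False
    have "cocyclic_of_type 2 \<infinity> (roots_group 2 (cocyclic_exponent 2 \<infinity>))"
      using comm_group_roots by (simp add: cocyclic_of_type_iff iso_refl)
    then show ?thesis
      using False unfolding cocyclic_def G_def by auto
  qed
  moreover have "|{\<alpha> \<in> Field \<kappa>. cocyclic_of_type p n (H \<alpha>)}| =o \<kappa>" if p: "prime p" for p n
  proof (rule card_eq_kappa)
    show "|{\<alpha> \<in> Field \<kappa>. cocyclic_of_type p n (H \<alpha>)}| \<le>o \<kappa>"
      using ordLeq_ordIso_trans[OF card_of_mono1 card_of_Field_ordIso[OF card_order]] by auto
    show "\<not> small {\<alpha> \<in> Field \<kappa>. cocyclic_of_type p n (H \<alpha>)}"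
    proof
      assume small: "small {\<alpha> \<in> Field \<kappa>. cocyclic_of_type p n (H \<alpha>)}"
      define \<psi> where "\<psi> \<alpha> = inv_into (Field \<kappa>) \<phi> (\<alpha>, (p, n))" for \<alpha>
      have \<psi>: "\<psi> \<alpha> \<in> Field \<kappa>" "\<phi> (\<psi> \<alpha>) = (\<alpha>, (p, n))" if "\<alpha> \<in> Field \<kappa>" for \<alpha>
        using that \<phi> unfolding \<psi>_def bij_betw_def by (auto intro: inv_into_into f_inv_into_f)
      have "inj_on \<psi> (Field \<kappa>)"
        using \<psi>(2) by (metis (no_types, lifting) Pair_inject inj_onI)
      moreover have "\<psi> ` Field \<kappa> \<subseteq> {\<alpha> \<in> Field \<kappa>. cocyclic_of_type p n (H \<alpha>)}"
        using \<psi> G[OF p] by (auto simp: H_def)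
      ultimately have "small (Field \<kappa>)"
        using small_inj_on small by blast
      then show False
        using not_small[OF card_of_Field_ordIso[OF card_order]] by blast
    qed
  qed
  ultimately have "cocyclic_family \<kappa> H"
    unfolding cocyclic_family_def H_def by blast
  then show ?thesis by blast
qed

end

theorem mainTheorem4:
  fixes \<kappa> :: "'k rel"
  assumes "strongly_inaccessible \<kappa>"
    and "\<kappa> \<le>o |UNIV :: 'a set|"
  shows "fraisse_class \<kappa> (small_groups \<kappa> :: 'a monoid set) \<and>
    (\<exists>F :: 'a monoid.
       comm_group F \<and> |carrier F| =o \<kappa> \<and>
       pure_injective_for F (small_groups \<kappa> :: 'a monoid set) \<and>
       (\<forall>F' :: 'b monoid.
          comm_group F' \<and> |carrier F'| =o \<kappa> \<and>
          pure_injective_for F' (small_groups \<kappa> :: 'a monoid set) \<longrightarrow> F' \<cong> F) \<and>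
       (\<forall>H :: 'k \<Rightarrow> 'c monoid.
          cocyclic_family \<kappa> H \<longrightarrow> F \<cong> supported_product \<kappa> H)) \<and>
    (\<exists>H :: 'k \<Rightarrow> complex monoid. cocyclic_family \<kappa> H)"
proof -
  interpret inaccessible \<kappa>
    by unfold_locales (rule assms(1))
  \<comment> \<open>One reference family over the complex numbers; F is a copy on \<open>'a\<close>
    of its product, so that F is fixed before any family over \<open>'c\<close> is
    considered.\<close>
  obtain H0 :: "'k \<Rightarrow> complex monoid" where H0: "cocyclic_family \<kappa> H0"
    using cocyclic_family_exists by blast
  interpret H0: cocyclic_product \<kappa> H0
    by unfold_locales (rule H0)
  have "|carrier H0.P| \<le>o |UNIV :: 'a set|"
    using ordIso_ordLeq_trans[OF H0.card_P assms(2)] .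
  then obtain j :: "('k \<Rightarrow> complex) \<Rightarrow> 'a" where j: "inj_on j (carrier H0.P)"
    using iffD2[OF card_of_ordLeq] by blast
  define F where "F = image_group j H0.P"
  have F: "comm_group F" and iso: "j \<in> iso H0.P F"
    unfolding F_def using comm_group_image_group[OF H0.comm_group_P j] by auto
  have "bij_betw j (carrier H0.P) (carrier F)"
    using iso by (simp add: iso_def)
  then have card: "|carrier F| =o \<kappa>"
    using ordIso_transitive[OF ordIso_symmetric[OF card_of_ordIsoI] H0.card_P] by blast
  have inj: "pure_injective_for F (small_groups \<kappa> :: 'a monoid set)"
    by (rule pure_injective_for_iso[OF H0.comm_group_P F _ _ H0.pure_injective_P])
      (use iso small_groupsD(2) in \<open>auto simp: is_iso_def\<close>)
  \<comment> \<open>F' is tested on groups over \<open>'a\<close>, the type of F, by assumption; F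
    has to be tested on groups over \<open>'b\<close>, which
    \<open>pure_injective_for_transfer\<close> provides.\<close>
  have "F' \<cong> F"
    if "comm_group F'" "|carrier F'| =o \<kappa>" "pure_injective_for F' (small_groups \<kappa> :: 'a monoid set)"
    for F' :: "'b monoid"
    using pure_injective_unique[OF that(1) F that(2) card that(3)
        pure_injective_for_transfer[OF assms(2) F inj]] .
  \<comment> \<open>The product of any such family has the size and the pure-injectivity that
    determine F up to isomorphism, so its coordinates are never matched with those of
    \<open>H0\<close>.\<close>
  moreover have "F \<cong> supported_product \<kappa> H" if "cocyclic_family \<kappa> H" for H :: "'k \<Rightarrow> 'c monoid"
  proof -
    interpret H: cocyclic_product \<kappa> H
      by unfold_locales (rule that)
    show ?thesis
      using pure_injective_unique[OF F H.comm_group_P card H.card_P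
          pure_injective_for_transfer[OF assms(2) F inj] H.pure_injective_P] .
  qed
  ultimately show ?thesis
    using fraisse_class_small_groups[OF F inj] F card inj cocyclic_family_exists by blast
qed

end
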